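(* The functors $\mathcal{G}:\mathbf{isCat}\to\mathbf{liGrpd}$ and $\mathcal{I}:\mathbf{liGrpd}\to\mathbf{isCat}$ form an equivalence of categories, where $\mathbf{isCat}$ is the category of inverse semicategories (and semifunctors) and $\mathbf{liGrpd}$ is the category of locally inductive groupoids and locally inductive functors.
   Context: Composition is written right to left: $gf$ means first $f$, then $g$. **Inverse semicategories.** A semicategory is defined like a category but without requiring identity arrows; a semifunctor is a map on objects and arrows preserving domains, codomains and composition. An inverse semicategory is a semicategory $\mathbf{X}$ in which for each arrow $f:A\to B$ there is a unique arrow $f^\circ:B\to A$ with $ff^\circ f=f$ and $f^\circ f f^\circ=f^\circ$. Put $\overline{f}=f^\circ f:A\to A$. For parallel arrows $f,g$ put $f\le g$ iff $f=g\overline{f}$. For an object $A$ let $E_A=\{\overline{f}\mid f:A\to A\text{ in }\mathbf{X}\}$. **Ordered groupoids.** An ordered groupoid is a groupoid $\mathbf{G}$ with a partial order $\le$ on its arrows (and on objects via $A\le B$ iff $1_A\le 1_B$) such that: (i) $f\le g$ implies $f^{-1}\le g^{-1}$; (ii) if $a\le A$, $b\le B$ and the composites $ab$, $AB$ exist, then $ab\le AB$; (iii) for each arrow $f:A'\to B$ and object $A\le A'$ there is a unique arrow $[f|_*A]\le f$ with domain $A$ (restriction); (iv) for each arrow $f:A\to B'$ and object $B\le B'$ there is a unique arrow $[B\,{}_*|f]\le f$ with codomain $B$ (corestriction). An ordered functor is a functor between ordered groupoids preserving $\le$ on arrows. If $\mathrm{dom}(\alpha)\wedge\mathrm{cod}(\beta)$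 exists, the tensor product is $\alpha\otimes\beta=[\alpha|_*\,\mathrm{dom}(\alpha)\wedge\mathrm{cod}(\beta)]\,[\mathrm{dom}(\alpha)\wedge\mathrm{cod}(\beta)\,{}_*|\beta]$. **Locally inductive groupoids.** An ordered groupoid $\mathbf{G}$ is locally inductive if there is a partition $\{M_i\}_{i\in I}$ of its set of objects $\mathbf{G}_0$ into meet-semilattices $M_i$ (a top element is not required) such that any two comparable objects lie in the same $M_i$. An ordered functor between locally inductive groupoids is locally inductive if it preserves all meets that exist; in particular, it preserves empty meets and thus top elements. **The functor $\mathcal{G}$.** For an inverse semicategory $\mathbf{X}$, $\mathcal{G}(\mathbf{X})$ has object set $\coprod_{A\in\mathbf{X}_0}E_A$, partitioned by the $E_A$; each arrow $f:A\to B$ of $\mathbf{X}$ gives exactly one arrow $f:\overline{f}\to\overline{f^\circ}$ (with $\overline f\in E_A$, $\overline{f^\circ}\in E_B$), and these are all the arrows; composition is that of $\mathbf{X}$, the identity at $\overline{f}$ is $\overline{f}$, the inverse of $f$ is $f^\circ$, and the order is that of $\mathbf{X}$. For a semifunctor $F:\mathbf{X}\to\mathbf{Y}$, $\mathcal{G}(F)$ sends the object $\overline f$ to $F(\overline f)$ and the arrow $f$ to $F(f)$. **The functor $\mathcal{I}$.** For a locally inductive groupoid $\mathbf{G}$ with partition $\{M_i\}$, $\mathcal{I}(\mathbf{G})$ has objects the $M_i$; arrows $M_1\to M_2$ are the arrows $f:A_1\to A_2$ of $\mathbf{G}$ with $A_1\in M_1$, $A_2\in M_2$; composition is $g\circ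 f=g\otimes f$; and $f^\circ=f^{-1}$. For a locally inductive functor $F:\mathbf{G}\to\mathbf{H}$, $\mathcal{I}(F)$ sends $M$ to the block $M'$ of the partition of $\mathbf{H}_0$ with $F(M)\subseteq M'$ and sends an arrow $f$ to $F(f)$.
   Formalization: Locally inductive functors are required to preserve only nonempty finite meets (not empty or infinite ones, which semifunctors need not preserve), and inverse semicategories are required to have every E_A nonempty (no objects without arrows), since otherwise the claim fails. *)

theory Defs
  imports "HOL-Library.FuncSet"
begin

section \<open>Semicategories, categories, functors\<close>

text \<open>
  Structures live on carriers inside types; the operations are total functions whose values
  outside the carrier (or on non-composable pairs) are irrelevant. Composition is written right
  to left: \<open>g \<cdot> f\<close> is defined when \<open>Dom g = Cod f\<close>. Since every arrow has one domain and one
  codomain, hom-sets are pairwise disjoint.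
\<close>

record ('o, 'a) semicat =
  Obj :: "'o set"
  Arr :: "'a set"
  Dom :: "'a \<Rightarrow> 'o"
  Cod :: "'a \<Rightarrow> 'o"
  Comp :: "'a \<Rightarrow> 'a \<Rightarrow> 'a"  (infixl "\<cdot>\<index>" 70)

record ('o, 'a) cat = "('o, 'a) semicat" +
  Ident :: "'o \<Rightarrow> 'a"

locale semicategory =
  fixes X :: "('o, 'a, 'z) semicat_scheme" (structure)
  assumes Dom_in: "f \<in> Arr X \<Longrightarrow> Dom X f \<in> Obj X"
    and Cod_in: "f \<in> Arr X \<Longrightarrow> Cod X f \<in> Obj X"
    and Comp_in: "\<lbrakk>f \<in> Arr X; g \<in> Arr X; Dom X g = Cod X f\<rbrakk> \<Longrightarrow> g \<cdot> f \<in> Arr X"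
    and Dom_Comp: "\<lbrakk>f \<in> Arr X; g \<in> Arr X; Dom X g = Cod X f\<rbrakk> \<Longrightarrow> Dom X (g \<cdot> f) = Dom X f"
    and Cod_Comp: "\<lbrakk>f \<in> Arr X; g \<in> Arr X; Dom X g = Cod X f\<rbrakk> \<Longrightarrow> Cod X (g \<cdot> f) = Cod X g"
    and Comp_assoc: "\<lbrakk>f \<in> Arr X; g \<in> Arr X; h \<in> Arr X; Dom X g = Cod X f; Dom X h = Cod X g\<rbrakk>
      \<Longrightarrow> h \<cdot> g \<cdot> f = h \<cdot> (g \<cdot> f)"

locale category = semicategory C for C :: "('o, 'a, 'z) cat_scheme" (structure) +
  assumes Ident_in: "A \<in> Obj C \<Longrightarrow> Ident C A \<in> Arr C"
    and Dom_Ident: "A \<in> Obj C \<Longrightarrow> Dom C (Ident C A) = A"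
    and Cod_Ident: "A \<in> Obj C \<Longrightarrow> Cod C (Ident C A) = A"
    and Comp_Ident: "f \<in> Arr C \<Longrightarrow> f \<cdot> Ident C (Dom C f) = f"
    and Ident_Comp: "f \<in> Arr C \<Longrightarrow> Ident C (Cod C f) \<cdot> f = f"

record ('o, 'a, 'p, 'b) fmap =
  omap :: "'o \<Rightarrow> 'p"
  amap :: "'a \<Rightarrow> 'b"

definition semifunctor ::
  "('o, 'a, 'y) semicat_scheme \<Rightarrow> ('p, 'b, 'z) semicat_scheme \<Rightarrow> ('o, 'a, 'p, 'b) fmap \<Rightarrow> bool"
where
  "semifunctor X Y F \<longleftrightarrow>
     omap F \<in> Obj X \<rightarrow> Obj Y \<and>
     amap F \<in> Arr X \<rightarrow> Arr Y \<and>
     (\<forall>f\<in>Arr X. Dom Y (amap F f) = omap F (Dom X f)) \<and>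
     (\<forall>f\<in>Arr X. Cod Y (amap F f) = omap F (Cod X f)) \<and>
     (\<forall>f\<in>Arr X. \<forall>g\<in>Arr X. Dom X g = Cod X f \<longrightarrow>
        amap F (g \<cdot>\<^bsub>X\<^esub> f) = amap F g \<cdot>\<^bsub>Y\<^esub> amap F f)"

definition cat_functor ::
  "('o, 'a, 'y) cat_scheme \<Rightarrow> ('p, 'b, 'z) cat_scheme \<Rightarrow> ('o, 'a, 'p, 'b) fmap \<Rightarrow> bool"
where
  "cat_functor C D F \<longleftrightarrow>
     semifunctor C D F \<and> (\<forall>A\<in>Obj C. amap F (Ident C A) = Ident D (omap F A))"

text \<open>Used to make equality of maps mean equality on the carriers.\<close>

definition fmap_extensional ::
  "('o, 'a, 'z) semicat_scheme \<Rightarrow> ('o, 'a, 'p, 'b) fmap \<Rightarrow> bool"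
where
  "fmap_extensional X F \<longleftrightarrow> omap F \<in> extensional (Obj X) \<and> amap F \<in> extensional (Arr X)"

definition fmap_id :: "('o, 'a, 'z) semicat_scheme \<Rightarrow> ('o, 'a, 'o, 'a) fmap"
where
  "fmap_id X = \<lparr>omap = (\<lambda>A\<in>Obj X. A), amap = (\<lambda>f\<in>Arr X. f)\<rparr>"

definition fmap_comp ::
  "('o, 'a, 'z) semicat_scheme \<Rightarrow> ('p, 'b, 'q, 'c) fmap \<Rightarrow> ('o, 'a, 'p, 'b) fmap
    \<Rightarrow> ('o, 'a, 'q, 'c) fmap"
where
  "fmap_comp X K F =
     \<lparr>omap = compose (Obj X) (omap K) (omap F), amap = compose (Arr X) (amap K) (amap F)\<rparr>"

definition inverse_arrows :: "('o, 'a, 'z) cat_scheme \<Rightarrow> 'a \<Rightarrow> 'a \<Rightarrow> bool"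
where
  "inverse_arrows C f g \<longleftrightarrow>
     f \<in> Arr C \<and> g \<in> Arr C \<and> Dom C g = Cod C f \<and> Cod C g = Dom C f \<and>
     g \<cdot>\<^bsub>C\<^esub> f = Ident C (Dom C f) \<and> f \<cdot>\<^bsub>C\<^esub> g = Ident C (Cod C f)"

definition iso_arrow :: "('o, 'a, 'z) cat_scheme \<Rightarrow> 'a \<Rightarrow> bool"
where
  "iso_arrow C f \<longleftrightarrow> (\<exists>g. inverse_arrows C f g)"

definition inv_arrow :: "('o, 'a, 'z) cat_scheme \<Rightarrow> 'a \<Rightarrow> 'a"
where
  "inv_arrow C f = (THE g. inverse_arrows C f g)"

definition natural_isomorphism ::
  "('o, 'a, 'y) cat_scheme \<Rightarrow> ('p, 'b, 'z) cat_scheme \<Rightarrow>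
   ('o, 'a, 'p, 'b) fmap \<Rightarrow> ('o, 'a, 'p, 'b) fmap \<Rightarrow> ('o \<Rightarrow> 'b) \<Rightarrow> bool"
where
  "natural_isomorphism C D F K \<eta> \<longleftrightarrow>
     (\<forall>A\<in>Obj C. \<eta> A \<in> Arr D \<and> Dom D (\<eta> A) = omap F A \<and> Cod D (\<eta> A) = omap K A \<and>
        iso_arrow D (\<eta> A)) \<and>
     (\<forall>f\<in>Arr C. amap K f \<cdot>\<^bsub>D\<^esub> \<eta> (Dom C f) = \<eta> (Cod C f) \<cdot>\<^bsub>D\<^esub> amap F f)"

definition equivalence_of_categories ::
  "('o, 'a, 'y) cat_scheme \<Rightarrow> ('p, 'b, 'z) cat_scheme \<Rightarrow>
   ('o, 'a, 'p, 'b) fmap \<Rightarrow> ('p, 'b, 'o, 'a) fmap \<Rightarrow> bool"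
where
  "equivalence_of_categories C D F K \<longleftrightarrow>
     category C \<and> category D \<and> cat_functor C D F \<and> cat_functor D C K \<and>
     (\<exists>\<eta>. natural_isomorphism C C (fmap_id C) (fmap_comp C K F) \<eta>) \<and>
     (\<exists>\<epsilon>. natural_isomorphism D D (fmap_comp D F K) (fmap_id D) \<epsilon>)"

section \<open>Inverse semicategories\<close>

definition regular_pair :: "('o, 'a, 'z) semicat_scheme \<Rightarrow> 'a \<Rightarrow> 'a \<Rightarrow> bool"
where
  "regular_pair X f g \<longleftrightarrow>
     g \<in> Arr X \<and> Dom X g = Cod X f \<and> Cod X g = Dom X f \<and>
     f \<cdot>\<^bsub>X\<^esub> g \<cdot>\<^bsub>X\<^esub> f = f \<and> g \<cdot>\<^bsub>X\<^esub> f \<cdot>\<^bsub>X\<^esub> g = g"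

locale inverse_semicategory = semicategory X
  for X :: "('o, 'a, 'z) semicat_scheme" (structure) +
  assumes ex1_circ: "f \<in> Arr X \<Longrightarrow> \<exists>!g. regular_pair X f g"

definition circ :: "('o, 'a, 'z) semicat_scheme \<Rightarrow> 'a \<Rightarrow> 'a"
where
  "circ X f = (THE g. regular_pair X f g)"

definition bar :: "('o, 'a, 'z) semicat_scheme \<Rightarrow> 'a \<Rightarrow> 'a"
where
  "bar X f = circ X f \<cdot>\<^bsub>X\<^esub> f"

definition nat_le :: "('o, 'a, 'z) semicat_scheme \<Rightarrow> 'a \<Rightarrow> 'a \<Rightarrow> bool"
where
  "nat_le X f g \<longleftrightarrow>
     f \<in> Arr X \<and> g \<in> Arr X \<and> Dom X f = Dom X g \<and> Cod X f = Cod X g \<and>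
     f = g \<cdot>\<^bsub>X\<^esub> bar X f"

text \<open>The set \<open>E\<^sub>A\<close>.\<close>

definition idems :: "('o, 'a, 'z) semicat_scheme \<Rightarrow> 'o \<Rightarrow> 'a set"
where
  "idems X A = {bar X f |f. f \<in> Arr X \<and> Dom X f = A \<and> Cod X f = A}"

section \<open>Locally inductive groupoids\<close>

record ('o, 'a) ord_grpd = "('o, 'a) cat" +
  Le :: "'a \<Rightarrow> 'a \<Rightarrow> bool"

definition obj_le :: "('o, 'a, 'z) ord_grpd_scheme \<Rightarrow> 'o \<Rightarrow> 'o \<Rightarrow> bool"
where
  "obj_le G A B \<longleftrightarrow> Le G (Ident G A) (Ident G B)"

locale ordered_groupoid = category G
  for G :: "('o, 'a, 'z) ord_grpd_scheme" (structure) +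
  assumes groupoid: "f \<in> Arr G \<Longrightarrow> iso_arrow G f"
    and Le_refl: "f \<in> Arr G \<Longrightarrow> Le G f f"
    and Le_trans: "\<lbrakk>f \<in> Arr G; g \<in> Arr G; h \<in> Arr G; Le G f g; Le G g h\<rbrakk> \<Longrightarrow> Le G f h"
    and Le_antisym: "\<lbrakk>f \<in> Arr G; g \<in> Arr G; Le G f g; Le G g f\<rbrakk> \<Longrightarrow> f = g"
    and Le_inv: "\<lbrakk>f \<in> Arr G; g \<in> Arr G; Le G f g\<rbrakk> \<Longrightarrow> Le G (inv_arrow G f) (inv_arrow G g)"
    and Le_Comp: "\<lbrakk>a \<in> Arr G; b \<in> Arr G; a' \<in> Arr G; b' \<in> Arr G; Le G a a'; Le G b b';
        Dom G a = Cod G b; Dom G a' = Cod G b'\<rbrakk> \<Longrightarrow> Le G (a \<cdot> b) (a' \<cdot> b')"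
    and ex1_restr: "\<lbrakk>f \<in> Arr G; A \<in> Obj G; obj_le G A (Dom G f)\<rbrakk>
        \<Longrightarrow> \<exists>!g. g \<in> Arr G \<and> Le G g f \<and> Dom G g = A"
    and ex1_corestr: "\<lbrakk>f \<in> Arr G; B \<in> Obj G; obj_le G B (Cod G f)\<rbrakk>
        \<Longrightarrow> \<exists>!g. g \<in> Arr G \<and> Le G g f \<and> Cod G g = B"

definition restr :: "('o, 'a, 'z) ord_grpd_scheme \<Rightarrow> 'a \<Rightarrow> 'o \<Rightarrow> 'a"
where
  "restr G f A = (THE g. g \<in> Arr G \<and> Le G g f \<and> Dom G g = A)"

definition corestr :: "('o, 'a, 'z) ord_grpd_scheme \<Rightarrow> 'o \<Rightarrow> 'a \<Rightarrow> 'a"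
where
  "corestr G B f = (THE g. g \<in> Arr G \<and> Le G g f \<and> Cod G g = B)"

text \<open>\<open>m\<close> is the meet of \<open>S\<close> in the subposet \<open>K\<close> of the objects.\<close>

definition is_meet :: "('o, 'a, 'z) ord_grpd_scheme \<Rightarrow> 'o set \<Rightarrow> 'o set \<Rightarrow> 'o \<Rightarrow> bool"
where
  "is_meet G K S m \<longleftrightarrow>
     S \<subseteq> K \<and> m \<in> K \<and> (\<forall>A\<in>S. obj_le G m A) \<and>
     (\<forall>D\<in>K. (\<forall>A\<in>S. obj_le G D A) \<longrightarrow> obj_le G D m)"

definition meet :: "('o, 'a, 'z) ord_grpd_scheme \<Rightarrow> 'o \<Rightarrow> 'o \<Rightarrow> 'o"
where
  "meet G A B = (THE m. is_meet G (Obj G) {A, B} m)"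

definition tensor :: "('o, 'a, 'z) ord_grpd_scheme \<Rightarrow> 'a \<Rightarrow> 'a \<Rightarrow> 'a"
where
  "tensor G \<alpha> \<beta> =
     (let m = meet G (Dom G \<alpha>) (Cod G \<beta>) in restr G \<alpha> m \<cdot>\<^bsub>G\<^esub> corestr G m \<beta>)"

text \<open>The partition is an indexed family \<open>{M\<^sub>i}\<close>, \<open>i \<in> I\<close>: \<open>Ind\<close> is \<open>I\<close> and \<open>Blk i\<close> is \<open>M\<^sub>i\<close>.\<close>

record ('i, 'o, 'a) li_grpd = "('o, 'a) ord_grpd" +
  Ind :: "'i set"
  Blk :: "'i \<Rightarrow> 'o set"

locale locally_inductive_groupoid = ordered_groupoid G
  for G :: "('i, 'o, 'a, 'z) li_grpd_scheme" (structure) +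
  assumes Blk_cover: "(\<Union>i\<in>Ind G. Blk G i) = Obj G"
    and Blk_nonempty: "i \<in> Ind G \<Longrightarrow> Blk G i \<noteq> {}"
    and Blk_disjoint: "\<lbrakk>i \<in> Ind G; j \<in> Ind G; i \<noteq> j\<rbrakk> \<Longrightarrow> Blk G i \<inter> Blk G j = {}"
    and Blk_semilattice: "\<lbrakk>i \<in> Ind G; A \<in> Blk G i; B \<in> Blk G i\<rbrakk>
        \<Longrightarrow> \<exists>m. is_meet G (Blk G i) {A, B} m"
    and Blk_comparable: "\<lbrakk>i \<in> Ind G; j \<in> Ind G; A \<in> Blk G i; B \<in> Blk G j; obj_le G A B\<rbrakk>
        \<Longrightarrow> i = j"

definition ordered_functor ::
  "('o, 'a, 'y) ord_grpd_scheme \<Rightarrow> ('p, 'b, 'z) ord_grpd_scheme \<Rightarrow> ('o, 'a, 'p, 'b) fmap \<Rightarrow> bool"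
where
  "ordered_functor G H F \<longleftrightarrow>
     cat_functor G H F \<and>
     (\<forall>f\<in>Arr G. \<forall>g\<in>Arr G. Le G f g \<longrightarrow> Le H (amap F f) (amap F g))"

text \<open>
  The meets in question are those of nonempty finite families, the ones a meet-semilattice
  without top has. Preservation of empty meets (tops) cannot be required: a semifunctor need not
  preserve identities, for instance the semigroup homomorphism \<open>{1} \<rightarrow> {0, 1}\<close>, \<open>1 \<mapsto> 0\<close>, does not,
  and \<open>\<G>\<close> turns identities into top elements. Infinite meets of idempotents are not preserved by
  semifunctors either.
\<close>

definition locally_inductive_functor ::
  "('i, 'o, 'a, 'y) li_grpd_scheme \<Rightarrow> ('j, 'p, 'b, 'z) li_grpd_scheme
    \<Rightarrow> ('o, 'a, 'p, 'b) fmap \<Rightarrow> bool"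
where
  "locally_inductive_functor G H F \<longleftrightarrow>
     ordered_functor G H F \<and>
     (\<forall>S m. finite S \<and> S \<noteq> {} \<and> is_meet G (Obj G) S m
        \<longrightarrow> is_meet H (Obj H) (omap F ` S) (omap F m))"

section \<open>The categories \<open>isCat\<close> and \<open>liGrpd\<close>\<close>

text \<open>
  Everything is small relative to a type \<open>'u\<close>, which plays the role of the universe: objects,
  arrows and partition indices of the structures are elements of \<open>'u\<close>. An arrow of \<open>isCat\<close> or
  \<open>liGrpd\<close> is a triple (source, target, underlying map).
\<close>

type_synonym 'u isc = "('u, 'u) semicat"
type_synonym 'u lig = "('u, 'u, 'u) li_grpd"
type_synonym ('s, 'u) arrow = "'s \<times> 's \<times> ('u, 'u, 'u, 'u) fmap"

text \<open>
  An object without arrows would have \<open>E\<^sub>A = {}\<close>, which is no block of a partition; such an object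
  is invisible in \<open>\<G>(X)\<close>, and \<open>\<G>\<close> would fail to be faithful. Hence \<open>E\<^sub>A \<noteq> {}\<close> is required.
\<close>

definition isCat :: "('u isc, ('u isc, 'u) arrow) cat"
where
  "isCat =
    (let O' = {X. inverse_semicategory X \<and> (\<forall>A\<in>Obj X. idems X A \<noteq> {})} in
     \<lparr>Obj = O',
      Arr = {(X, Y, F). X \<in> O' \<and> Y \<in> O' \<and> semifunctor X Y F \<and> fmap_extensional X F},
      Dom = (\<lambda>(X, Y, F). X),
      Cod = (\<lambda>(X, Y, F). Y),
      Comp = (\<lambda>(Y', Z, K) (X, Y, F). (X, Z, fmap_comp X K F)),
      Ident = (\<lambda>X. (X, X, fmap_id X))\<rparr>)"

definition liGrpd :: "('u lig, ('u lig, 'u) arrow) cat"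
where
  "liGrpd =
    (let O' = {G. locally_inductive_groupoid G} in
     \<lparr>Obj = O',
      Arr = {(G, H, F). G \<in> O' \<and> H \<in> O' \<and> locally_inductive_functor G H F \<and>
                        fmap_extensional G F},
      Dom = (\<lambda>(G, H, F). G),
      Cod = (\<lambda>(G, H, F). H),
      Comp = (\<lambda>(H', K, L) (G, H, F). (G, K, fmap_comp G L F)),
      Ident = (\<lambda>G. (G, G, fmap_id G))\<rparr>)"

section \<open>The functors \<open>\<G>\<close> and \<open>\<I>\<close>\<close>

text \<open>
  The sets \<open>E\<^sub>A\<close> are pairwise disjoint sets of arrows, so their coproduct is taken to be their
  union. The objects of \<open>\<I>(G)\<close> are the blocks, each named by its index; as the blocks are nonempty
  and disjoint this naming is one-to-one.
\<close>

definition G_obj :: "'u isc \<Rightarrow> 'u lig"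
where
  "G_obj X =
     \<lparr>Obj = (\<Union>A\<in>Obj X. idems X A),
      Arr = Arr X,
      Dom = bar X,
      Cod = (\<lambda>f. bar X (circ X f)),
      Comp = Comp X,
      Ident = (\<lambda>e. e),
      Le = nat_le X,
      Ind = Obj X,
      Blk = idems X\<rparr>"

definition G_functor :: "('u isc, ('u isc, 'u) arrow, 'u lig, ('u lig, 'u) arrow) fmap"
where
  "G_functor =
     \<lparr>omap = G_obj,
      amap = (\<lambda>(X, Y, F). (G_obj X, G_obj Y,
        \<lparr>omap = restrict (amap F) (Obj (G_obj X)), amap = amap F\<rparr>))\<rparr>"

definition I_obj :: "'u lig \<Rightarrow> 'u isc"
where
  "I_obj G =
     \<lparr>Obj = Ind G,
      Arr = Arr G,
      Dom = (\<lambda>f. THE i. i \<in> Ind G \<and> Dom G f \<in> Blk G i),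
      Cod = (\<lambda>f. THE i. i \<in> Ind G \<and> Cod G f \<in> Blk G i),
      Comp = tensor G\<rparr>"

definition I_functor :: "('u lig, ('u lig, 'u) arrow, 'u isc, ('u isc, 'u) arrow) fmap"
where
  "I_functor =
     \<lparr>omap = I_obj,
      amap = (\<lambda>(G, H, F). (I_obj G, I_obj H,
        \<lparr>omap = (\<lambda>i\<in>Ind G. THE j. j \<in> Ind H \<and> omap F ` Blk G i \<subseteq> Blk H j),
         amap = amap F\<rparr>))\<rparr>"

end

theory Submission
  imports Defs
begin

text \<open>
  An arrow of an inverse semicategory \<open>X\<close> determines two idempotents, \<open>bar X f\<close> and
  \<open>bar X (circ X f)\<close>. Forming \<open>\<G>(X)\<close> keeps the arrows and takes these idempotents as domain and
  codomain, which turns \<open>circ\<close> into a groupoid inverse; in exchange only those composites remain in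
  which the idempotents in the middle agree. Nothing is lost, because the natural order remembers
  the rest: a composite \<open>g \<cdot> f\<close> of \<open>X\<close> equals \<open>(g \<cdot> m) \<cdot> (m \<cdot> f)\<close> with \<open>m = bar X g \<cdot> bar X (circ X f)\<close>,
  where \<open>m\<close> is the meet of the two idempotents and \<open>g \<cdot> m\<close>, \<open>m \<cdot> f\<close> are the restriction and the
  corestriction to it. That is the tensor product of \<open>\<G>(X)\<close> (\<open>tensor_G_obj\<close>), so \<open>\<I>(\<G>(X))\<close> has the
  objects, arrows and composition of \<open>X\<close>. In the other direction the objects of \<open>\<G>(\<I>(G))\<close> are the
  identities of \<open>G\<close>, the order of \<open>\<I>(G)\<close> is that of \<open>G\<close> (\<open>nat_le_I_obj\<close>), and a tensor product of
  composable arrows is their composite (\<open>tensor_Comp\<close>), so \<open>\<G>(\<I>(G))\<close> is \<open>G\<close> with each object renamed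
  to its identity.
  
  That \<open>\<G>(X)\<close> is locally inductive rests on the theory of inverse semigroups, done here for arrows
  between several objects: idempotents commute (\<open>idems_commute\<close>), so they form semilattices, and
  multiplying \<open>g\<close> by an idempotent on either side gives an arrow below \<open>g\<close>, which makes the order
  compatible with composition and pseudo-inverses.
  
  That \<open>\<I>(G)\<close> is an inverse semicategory has two difficult points. Associativity of the tensor product
  (\<open>tensor_assoc\<close>) follows from an intrinsic description: \<open>f \<otimes> g\<close> is the greatest composite of an arrow
  below \<open>f\<close> with an arrow below \<open>g\<close> (\<open>tensor_greatest\<close>). Uniqueness of pseudo-inverses
  (\<open>regular_pair_I_obj\<close>) holds because \<open>f \<otimes> g \<otimes> f = f\<close> and \<open>g \<otimes> f \<otimes> g = g\<close> leave no room for cutting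
  anything down, so \<open>f\<close> and \<open>g\<close> are composable on both sides and \<open>g\<close> is the groupoid inverse of \<open>f\<close>.
  
  On maps, a semifunctor preserves pseudo-inverses and hence idempotents, their products and the
  order, while a locally inductive functor preserves binary meets and restrictions, hence tensor
  products.
\<close>

section \<open>Categories of structured carriers\<close>

text \<open>
  Both \<open>isCat\<close> and \<open>liGrpd\<close> have structures as objects and structure-preserving maps as arrows; what
  depends only on this shape is proved here once, for a class \<open>S\<close> of structures and a predicate \<open>H\<close>
  singling out the admissible maps.
\<close>

definition concrete_cat ::
  "('o, 'a, 'z) semicat_scheme set \<Rightarrow>
   (('o, 'a, 'z) semicat_scheme \<Rightarrow> ('o, 'a, 'z) semicat_scheme \<Rightarrow> ('o, 'a, 'o, 'a) fmap \<Rightarrow> bool) \<Rightarrow>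
   (('o, 'a, 'z) semicat_scheme,
    ('o, 'a, 'z) semicat_scheme \<times> ('o, 'a, 'z) semicat_scheme \<times> ('o, 'a, 'o, 'a) fmap) cat"
where
  "concrete_cat S H =
     \<lparr>Obj = S,
      Arr = {(X, Y, F). X \<in> S \<and> Y \<in> S \<and> H X Y F \<and> fmap_extensional X F},
      Dom = (\<lambda>(X, Y, F). X),
      Cod = (\<lambda>(X, Y, F). Y),
      Comp = (\<lambda>(Y', Z, K) (X, Y, F). (X, Z, fmap_comp X K F)),
      Ident = (\<lambda>X. (X, X, fmap_id X))\<rparr>"

lemma fmap_simps [simp]:
  "A \<in> Obj X \<Longrightarrow> omap (fmap_id X) A = A"
  "f \<in> Arr X \<Longrightarrow> amap (fmap_id X) f = f"
  "A \<in> Obj X \<Longrightarrow> omap (fmap_comp X K F) A = omap K (omap F A)"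
  "f \<in> Arr X \<Longrightarrow> amap (fmap_comp X K F) f = amap K (amap F f)"
  by (simp_all add: fmap_id_def fmap_comp_def compose_def)

lemma fmap_extensional_id [simp]: "fmap_extensional X (fmap_id X)"
  by (simp add: fmap_extensional_def fmap_id_def)

lemma fmap_extensional_comp [simp]: "fmap_extensional X (fmap_comp X K F)"
  by (simp add: fmap_extensional_def fmap_comp_def compose_extensional)

lemma fmap_eqI:
  fixes F K :: "('o, 'a, 'p, 'b) fmap"
  assumes "fmap_extensional X F" "fmap_extensional X K"
    and "\<And>A. A \<in> Obj X \<Longrightarrow> omap F A = omap K A"
    and "\<And>f. f \<in> Arr X \<Longrightarrow> amap F f = amap K f"
  shows "F = K"
proof -
  have "omap F = omap K" "amap F = amap K"
    using assms by (auto simp: fmap_extensional_def intro: extensionalityI)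
  then show ?thesis by simp
qed

locale concrete_category =
  fixes S :: "('o, 'a, 'z) semicat_scheme set"
    and H :: "('o, 'a, 'z) semicat_scheme \<Rightarrow> ('o, 'a, 'z) semicat_scheme \<Rightarrow>
      ('o, 'a, 'o, 'a) fmap \<Rightarrow> bool"
  assumes omap_in: "\<lbrakk>H X Y F; A \<in> Obj X\<rbrakk> \<Longrightarrow> omap F A \<in> Obj Y"
    and amap_in: "\<lbrakk>H X Y F; f \<in> Arr X\<rbrakk> \<Longrightarrow> amap F f \<in> Arr Y"
    and H_id: "X \<in> S \<Longrightarrow> H X X (fmap_id X)"
    and H_comp: "\<lbrakk>X \<in> S; Y \<in> S; Z \<in> S; H X Y F; H Y Z K\<rbrakk> \<Longrightarrow> H X Z (fmap_comp X K F)"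
begin

lemma category: "category (concrete_cat S H)"
proof
  fix f g h
  assume f: "f \<in> Arr (concrete_cat S H)"
  show "Dom (concrete_cat S H) f \<in> Obj (concrete_cat S H)"
    and "Cod (concrete_cat S H) f \<in> Obj (concrete_cat S H)"
    using f by (auto simp: concrete_cat_def)
  obtain X Y F where f': "f = (X, Y, F)" by (cases f)
  have F: "H X Y F" "fmap_extensional X F" using f f' by (simp_all add: concrete_cat_def)
  have "fmap_comp X F (fmap_id X) = F" "fmap_comp X (fmap_id Y) F = F"
    using F by (auto intro!: fmap_eqI[of X] simp: omap_in[OF F(1)] amap_in[OF F(1)])
  then show "Comp (concrete_cat S H) f (Ident (concrete_cat S H) (Dom (concrete_cat S H) f)) = f"
    and "Comp (concrete_cat S H) (Ident (concrete_cat S H) (Cod (concrete_cat S H) f)) f = f"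
    by (simp_all add: concrete_cat_def f')
  assume g: "g \<in> Arr (concrete_cat S H)" and gf: "Dom (concrete_cat S H) g = Cod (concrete_cat S H) f"
  show "Comp (concrete_cat S H) g f \<in> Arr (concrete_cat S H)"
    and "Dom (concrete_cat S H) (Comp (concrete_cat S H) g f) = Dom (concrete_cat S H) f"
    and "Cod (concrete_cat S H) (Comp (concrete_cat S H) g f) = Cod (concrete_cat S H) g"
    using f g gf by (auto simp: concrete_cat_def intro: H_comp)
  assume h: "h \<in> Arr (concrete_cat S H)" and hg: "Dom (concrete_cat S H) h = Cod (concrete_cat S H) g"
  have "fmap_comp X (fmap_comp Y L K) F = fmap_comp X L (fmap_comp X K F)" for K L
    by (rule fmap_eqI[of X]) (simp_all add: omap_in[OF F(1)] amap_in[OF F(1)])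
  then show "Comp (concrete_cat S H) (Comp (concrete_cat S H) h g) f
      = Comp (concrete_cat S H) h (Comp (concrete_cat S H) g f)"
    using f' g gf h hg by (auto simp: concrete_cat_def)
next
  fix X assume "X \<in> Obj (concrete_cat S H)"
  then show "Ident (concrete_cat S H) X \<in> Arr (concrete_cat S H)"
    and "Dom (concrete_cat S H) (Ident (concrete_cat S H) X) = X"
    and "Cod (concrete_cat S H) (Ident (concrete_cat S H) X) = X"
    by (auto simp: concrete_cat_def intro: H_id)
qed

lemma iso_arrowI:
  assumes "X \<in> S" "Y \<in> S" "H X Y F" "fmap_extensional X F" "H Y X K" "fmap_extensional Y K"
    and "\<And>A. A \<in> Obj X \<Longrightarrow> omap K (omap F A) = A" "\<And>f. f \<in> Arr X \<Longrightarrow> amap K (amap F f) = f"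
    and "\<And>B. B \<in> Obj Y \<Longrightarrow> omap F (omap K B) = B" "\<And>g. g \<in> Arr Y \<Longrightarrow> amap F (amap K g) = g"
  shows "iso_arrow (concrete_cat S H) (X, Y, F)"
proof -
  have "fmap_comp X K F = fmap_id X" "fmap_comp Y F K = fmap_id Y"
    using assms by (auto intro: fmap_eqI[of X] fmap_eqI[of Y])
  then have "inverse_arrows (concrete_cat S H) (X, Y, F) (Y, X, K)"
    using assms by (simp add: inverse_arrows_def concrete_cat_def)
  then show ?thesis unfolding iso_arrow_def ..
qed

end

lemma concrete_cat_functorI:
  assumes S: "concrete_category S H" and T: "concrete_category T K"
    and Phi: "\<And>X. X \<in> S \<Longrightarrow> \<Phi> X \<in> T"
    and Psi: "\<And>X Y F. \<lbrakk>X \<in> S; Y \<in> S; H X Y F; fmap_extensional X F\<rbrakk>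
      \<Longrightarrow> K (\<Phi> X) (\<Phi> Y) (\<Psi> X Y F) \<and> fmap_extensional (\<Phi> X) (\<Psi> X Y F)"
    and Psi_id: "\<And>X. X \<in> S \<Longrightarrow> \<Psi> X X (fmap_id X) = fmap_id (\<Phi> X)"
    and Psi_comp: "\<And>X Y Z F L. \<lbrakk>X \<in> S; Y \<in> S; Z \<in> S; H X Y F; H Y Z L\<rbrakk>
      \<Longrightarrow> \<Psi> X Z (fmap_comp X L F) = fmap_comp (\<Phi> X) (\<Psi> Y Z L) (\<Psi> X Y F)"
  shows "cat_functor (concrete_cat S H) (concrete_cat T K)
    \<lparr>omap = \<Phi>, amap = (\<lambda>(X, Y, F). (\<Phi> X, \<Phi> Y, \<Psi> X Y F))\<rparr>"
  using Phi Psi Psi_id Psi_comp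
  by (auto simp: cat_functor_def semifunctor_def concrete_cat_def)

lemma semifunctor_id: "semicategory X \<Longrightarrow> semifunctor X X (fmap_id X)"
  by (auto simp: semifunctor_def semicategory.Dom_in semicategory.Cod_in semicategory.Comp_in)

lemma semifunctor_comp:
  assumes F: "semifunctor X Y F" and K: "semifunctor Y Z K" and X: "semicategory X"
  shows "semifunctor X Z (fmap_comp X K F)"
proof -
  have 1: "omap F A \<in> Obj Y" if "A \<in> Obj X" for A using F that by (auto simp: semifunctor_def)
  have 2: "amap F f \<in> Arr Y" if "f \<in> Arr X" for f using F that by (auto simp: semifunctor_def)
  have 3: "Dom Y (amap F f) = omap F (Dom X f)" "Cod Y (amap F f) = omap F (Cod X f)"
    if "f \<in> Arr X" for f using F that by (auto simp: semifunctor_def)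
  have 4: "Dom Z (amap K (amap F f)) = omap K (omap F (Dom X f))"
    "Cod Z (amap K (amap F f)) = omap K (omap F (Cod X f))" if "f \<in> Arr X" for f
    using K 2[OF that] 3[OF that] by (auto simp: semifunctor_def)
  have 5: "amap K (amap F (g \<cdot>\<^bsub>X\<^esub> f)) = amap K (amap F g) \<cdot>\<^bsub>Z\<^esub> amap K (amap F f)"
    if "f \<in> Arr X" "g \<in> Arr X" "Dom X g = Cod X f" for f g
  proof -
    have "amap F (g \<cdot>\<^bsub>X\<^esub> f) = amap F g \<cdot>\<^bsub>Y\<^esub> amap F f"
      using F that unfolding semifunctor_def by blast
    moreover have "amap K (g' \<cdot>\<^bsub>Y\<^esub> f') = amap K g' \<cdot>\<^bsub>Z\<^esub> amap K f'"
      if "f' \<in> Arr Y" "g' \<in> Arr Y" "Dom Y g' = Cod Y f'" for f' g'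
      using K that unfolding semifunctor_def by blast
    ultimately show ?thesis
      using 2[OF that(1)] 2[OF that(2)] 3[OF that(1)] 3[OF that(2)] that(3) by simp
  qed
  have 6: "omap K \<in> Obj Y \<rightarrow> Obj Z" "amap K \<in> Arr Y \<rightarrow> Arr Z"
    using K by (auto simp: semifunctor_def)
  show ?thesis
    unfolding semifunctor_def
    using 1 2 4 5 6
    by (auto simp: semicategory.Dom_in[OF X] semicategory.Cod_in[OF X] semicategory.Comp_in[OF X])
qed

section \<open>Idempotents and the natural order of an inverse semicategory\<close>

context inverse_semicategory
begin

lemmas comp_simps = Comp_in Dom_Comp Cod_Comp Comp_assoc

lemma regular_pair_circ: "f \<in> Arr X \<Longrightarrow> regular_pair X f (circ X f)"
  unfolding circ_def by (rule theI') (rule ex1_circ)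

lemma circ_eqI: "\<lbrakk>f \<in> Arr X; regular_pair X f g\<rbrakk> \<Longrightarrow> circ X f = g"
  using ex1_circ regular_pair_circ by blast

lemma circ_simps [simp]:
  assumes "f \<in> Arr X"
  shows "circ X f \<in> Arr X" "Dom X (circ X f) = Cod X f" "Cod X (circ X f) = Dom X f"
    "f \<cdot> (circ X f \<cdot> f) = f" "circ X f \<cdot> (f \<cdot> circ X f) = circ X f"
  using regular_pair_circ[OF assms] assms by (auto simp: regular_pair_def comp_simps)

lemma circ_cancel:
  assumes "f \<in> Arr X"
  shows "\<lbrakk>x \<in> Arr X; Cod X x = Dom X f\<rbrakk> \<Longrightarrow> f \<cdot> (circ X f \<cdot> (f \<cdot> x)) = f \<cdot> x"
    and "\<lbrakk>x \<in> Arr X; Cod X x = Cod X f\<rbrakk> \<Longrightarrow> circ X f \<cdot> (f \<cdot> (circ X f \<cdot> x)) = circ X f \<cdot> x"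
  using assms circ_simps[OF assms] by (simp_all flip: Comp_assoc add: Comp_in Dom_Comp Cod_Comp)

lemma circ_circ [simp]: "f \<in> Arr X \<Longrightarrow> circ X (circ X f) = f"
  by (rule circ_eqI) (simp_all add: regular_pair_def comp_simps)

lemma bar_simps [simp]:
  assumes "f \<in> Arr X"
  shows "bar X f \<in> Arr X" "Dom X (bar X f) = Dom X f" "Cod X (bar X f) = Dom X f"
    "f \<cdot> bar X f = f" "bar X f \<cdot> bar X f = bar X f"
  using assms by (simp_all add: bar_def comp_simps)

lemma circ_idem:
  assumes "e \<in> Arr X" "Cod X e = Dom X e" "e \<cdot> e = e"
  shows "circ X e = e"
  using assms by (intro circ_eqI) (simp_all add: regular_pair_def)

lemma idems_iff: "e \<in> idems X A \<longleftrightarrow> e \<in> Arr X \<and> Dom X e = A \<and> Cod X e = A \<and> e \<cdot> e = e"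
proof
  assume "e \<in> Arr X \<and> Dom X e = A \<and> Cod X e = A \<and> e \<cdot> e = e"
  then have "e = bar X e \<and> e \<in> Arr X \<and> Dom X e = A \<and> Cod X e = A"
    using circ_idem[of e] by (simp add: bar_def)
  then show "e \<in> idems X A"
    unfolding idems_def by blast
qed (auto simp: idems_def)

lemma idems_simps:
  assumes "e \<in> idems X A"
  shows "e \<in> Arr X" "Dom X e = A" "Cod X e = A" "e \<cdot> e = e" "circ X e = e" "bar X e = e"
    "\<lbrakk>x \<in> Arr X; Cod X x = A\<rbrakk> \<Longrightarrow> e \<cdot> (e \<cdot> x) = e \<cdot> x"
proof -
  show e: "e \<in> Arr X" "Dom X e = A" "Cod X e = A" "e \<cdot> e = e"
    using assms by (auto simp: idems_iff)
  then show "circ X e = e" "bar X e = e"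
    using circ_idem[of e] by (simp_all add: bar_def)
  show "\<lbrakk>x \<in> Arr X; Cod X x = A\<rbrakk> \<Longrightarrow> e \<cdot> (e \<cdot> x) = e \<cdot> x"
    using e by (simp flip: Comp_assoc)
qed

lemma bar_in_idems: "f \<in> Arr X \<Longrightarrow> bar X f \<in> idems X (Dom X f)"
  by (simp add: idems_iff)

lemma bar_circ_in_idems: "f \<in> Arr X \<Longrightarrow> bar X (circ X f) \<in> idems X (Cod X f)"
  by (simp add: idems_iff)

text \<open>
  Together with \<open>x = circ X (e \<cdot> f)\<close> also \<open>f \<cdot> x \<cdot> e\<close> is a pseudo-inverse of \<open>e \<cdot> f\<close>, so the two are
  equal, and \<open>(f \<cdot> x \<cdot> e) \<cdot> (f \<cdot> x \<cdot> e) = f \<cdot> (x \<cdot> (e \<cdot> f) \<cdot> x) \<cdot> e\<close> shows that \<open>x\<close> is idempotent. An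
  idempotent is its own pseudo-inverse, whence \<open>x = circ X x = e \<cdot> f\<close>.
\<close>

lemma idems_Comp:
  assumes "e \<in> idems X A" "f \<in> idems X A"
  shows "e \<cdot> f \<in> idems X A"
proof -
  note e = idems_simps[OF assms(1)] and f = idems_simps[OF assms(2)]
  have ef: "e \<cdot> f \<in> Arr X" "Dom X (e \<cdot> f) = A" "Cod X (e \<cdot> f) = A"
    using e f by (simp_all add: comp_simps)
  define x where "x = circ X (e \<cdot> f)"
  have x: "x \<in> Arr X" "Dom X x = A" "Cod X x = A" "e \<cdot> (f \<cdot> (x \<cdot> (e \<cdot> f))) = e \<cdot> f"
    "x \<cdot> (e \<cdot> (f \<cdot> x)) = x"
    using circ_simps[OF ef(1)] ef e f by (simp_all add: x_def[symmetric] comp_simps)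
  have x': "x \<cdot> (e \<cdot> (f \<cdot> (x \<cdot> z))) = x \<cdot> z" if "z \<in> Arr X" "Cod X z = A" for z
  proof -
    have "x \<cdot> z = x \<cdot> (e \<cdot> (f \<cdot> x)) \<cdot> z" by (simp only: x(5))
    then show ?thesis using x(1-3) e f that by (simp add: comp_simps)
  qed
  have "regular_pair X (e \<cdot> f) (f \<cdot> (x \<cdot> e))"
    using x x' e f by (simp add: regular_pair_def comp_simps)
  from circ_eqI[OF ef(1) this] have x_eq: "x = f \<cdot> (x \<cdot> e)"
    by (simp only: x_def[symmetric])
  then have "x \<cdot> x = f \<cdot> (x \<cdot> e) \<cdot> (f \<cdot> (x \<cdot> e))"
    by (rule arg_cong2[OF x_eq])
  also have "\<dots> = f \<cdot> (x \<cdot> (e \<cdot> (f \<cdot> (x \<cdot> e))))"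
    using x(1-3) e f by (simp add: comp_simps)
  also have "\<dots> = x"
    by (subst x'[OF e(1,3)]) (rule x_eq[symmetric])
  finally have xx: "x \<cdot> x = x" .
  then have "circ X x = x" using x by (intro circ_idem) simp_all
  moreover have "circ X x = e \<cdot> f" using ef by (simp add: x_def)
  ultimately show ?thesis using xx ef by (simp add: idems_iff)
qed

text \<open>
  Since \<open>e \<cdot> f\<close> and \<open>f \<cdot> e\<close> are idempotent, they are pseudo-inverse to each other; but the idempotent
  \<open>e \<cdot> f\<close> is also pseudo-inverse to itself.
\<close>

lemma idems_commute:
  assumes "e \<in> idems X A" "f \<in> idems X A"
  shows "e \<cdot> f = f \<cdot> e"
proof -
  note e = idems_simps[OF assms(1)] and f = idems_simps[OF assms(2)]
  note ef = idems_simps[OF idems_Comp[OF assms]] and fe = idems_simps[OF idems_Comp[OF assms(2,1)]]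
  have "regular_pair X (e \<cdot> f) (f \<cdot> e)"
    using e f ef(1-4) fe(1-4) by (simp add: regular_pair_def comp_simps)
  from circ_eqI[OF ef(1) this] show ?thesis using ef(5) by simp
qed

text \<open>
  Conjugation moves an idempotent from one side of an arrow to the other; applied to \<open>circ X g\<close>, it
  turns \<open>e \<cdot> g\<close> into \<open>g \<cdot> (circ X g \<cdot> e \<cdot> g)\<close>.
\<close>

lemma conj_in_idems:
  assumes f: "f \<in> Arr X" and e: "e \<in> idems X (Dom X f)"
  shows "f \<cdot> (e \<cdot> circ X f) \<in> idems X (Cod X f)"
proof -
  note e' = idems_simps[OF e]
  have "e \<cdot> bar X f \<cdot> (e \<cdot> circ X f) = bar X f \<cdot> e \<cdot> (e \<cdot> circ X f)"
    using idems_commute[OF e bar_in_idems[OF f]] by simp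
  then show ?thesis
    using f e' by (simp add: idems_iff comp_simps bar_def circ_cancel)
qed

text \<open>
  The idempotents \<open>f \<cdot> circ X f\<close> and \<open>circ X g \<cdot> g\<close> that meet in the middle of
  \<open>g \<cdot> f \<cdot> circ X f \<cdot> circ X g \<cdot> g \<cdot> f\<close> commute, and each is then absorbed by its neighbour.
\<close>

lemma circ_Comp:
  assumes f: "f \<in> Arr X" and g: "g \<in> Arr X" and gf: "Dom X g = Cod X f"
  shows "circ X (g \<cdot> f) = circ X f \<cdot> circ X g"
proof (rule circ_eqI)
  have c: "bar X (circ X f) \<cdot> bar X g = bar X g \<cdot> bar X (circ X f)"
    using bar_circ_in_idems[OF f] bar_in_idems[OF g] gf by (intro idems_commute) simp_all
  have "g \<cdot> ((bar X (circ X f) \<cdot> bar X g) \<cdot> f) = g \<cdot> f"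
    unfolding c using f g gf by (simp add: bar_def comp_simps circ_cancel)
  moreover have "circ X f \<cdot> ((bar X g \<cdot> bar X (circ X f)) \<cdot> circ X g) = circ X f \<cdot> circ X g"
    unfolding c[symmetric] using f g gf by (simp add: bar_def comp_simps circ_cancel)
  ultimately show "regular_pair X (g \<cdot> f) (circ X f \<cdot> circ X g)"
    using f g gf by (simp add: regular_pair_def bar_def comp_simps)
qed (use assms in \<open>simp add: comp_simps\<close>)

text \<open>
  The definition of \<open>f \<le> g\<close> prescribes the idempotent \<open>bar X f\<close> on the right of \<open>g\<close>. The following
  rules allow an arbitrary idempotent, on either side; the remaining properties of the order rest
  on this freedom.
\<close>

lemma nat_leI_right:
  assumes g: "g \<in> Arr X" and e: "e \<in> idems X (Dom X g)"
  shows "nat_le X (g \<cdot> e) g"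
proof -
  note e' = idems_simps[OF e]
  have "g \<cdot> (e \<cdot> bar X g \<cdot> e) = g \<cdot> (bar X g \<cdot> e \<cdot> e)"
    using idems_commute[OF e bar_in_idems[OF g]] by simp
  then have "g \<cdot> (e \<cdot> (bar X g \<cdot> e)) = g \<cdot> e"
    using g e' by (simp add: bar_def comp_simps circ_cancel)
  then show ?thesis
    using g e' by (simp add: nat_le_def bar_def comp_simps circ_Comp)
qed

lemma nat_leI_left:
  assumes g: "g \<in> Arr X" and e: "e \<in> idems X (Cod X g)"
  shows "nat_le X (e \<cdot> g) g"
proof -
  note e' = idems_simps[OF e]
  have "g \<cdot> (circ X g \<cdot> (e \<cdot> g)) = bar X (circ X g) \<cdot> e \<cdot> g"
    using g e' by (simp add: bar_def comp_simps)
  also have "\<dots> = e \<cdot> bar X (circ X g) \<cdot> g"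
    using idems_commute[OF e bar_circ_in_idems[OF g]] by simp
  also have "\<dots> = e \<cdot> g"
    using g e' by (simp add: bar_def comp_simps)
  finally have "g \<cdot> (circ X g \<cdot> (e \<cdot> g)) = e \<cdot> g" .
  moreover have "nat_le X (g \<cdot> (circ X g \<cdot> (e \<cdot> g))) g"
    using conj_in_idems[of "circ X g" e] g e by (intro nat_leI_right) simp_all
  ultimately show ?thesis by simp
qed

lemma nat_leE_right:
  assumes "nat_le X f g"
  obtains e where "e \<in> idems X (Dom X g)" "f = g \<cdot> e"
  using assms bar_in_idems[of f] unfolding nat_le_def by metis

lemma nat_le_circ:
  assumes fg: "nat_le X f g"
  shows "nat_le X (circ X f) (circ X g)"
proof -
  obtain e where e: "e \<in> idems X (Dom X g)" "f = g \<cdot> e" using fg by (rule nat_leE_right)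
  have g: "g \<in> Arr X" using fg by (simp add: nat_le_def)
  show "nat_le X (circ X f) (circ X g)"
    using nat_leI_left[of "circ X g" e] g e idems_simps[OF e(1)] by (simp add: circ_Comp)
qed

lemma nat_le_refl: "f \<in> Arr X \<Longrightarrow> nat_le X f f"
  by (simp add: nat_le_def)

lemma nat_le_trans:
  assumes gh: "nat_le X f g" "nat_le X g h"
  shows "nat_le X f h"
proof -
  obtain e where 1: "e \<in> idems X (Dom X g)" "f = g \<cdot> e" using gh(1) by (rule nat_leE_right)
  obtain e' where 2: "e' \<in> idems X (Dom X h)" "g = h \<cdot> e'" using gh(2) by (rule nat_leE_right)
  have d: "Dom X g = Dom X h" and h: "h \<in> Arr X" using gh by (auto simp: nat_le_def)
  show "nat_le X f h"
    using nat_leI_right[OF h idems_Comp[OF 2(1)], of e] 1 2 h idems_simps[OF 1(1)] idems_simps[OF 2(1)] d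
    by (simp add: comp_simps)
qed

lemma nat_le_antisym:
  assumes fg: "nat_le X f g" and gf: "nat_le X g f"
  shows "f = g"
proof -
  have a: "f \<in> Arr X" "g \<in> Arr X" "Dom X f = Dom X g" "f = g \<cdot> bar X f" "g = f \<cdot> bar X g"
    using fg gf by (auto simp: nat_le_def)
  have "g \<cdot> bar X f = f \<cdot> (bar X g \<cdot> bar X f)"
    using a by (metis Comp_assoc bar_simps(1,2,3))
  also have "\<dots> = f \<cdot> (bar X f \<cdot> bar X g)"
    using idems_commute bar_in_idems a(1-3) by metis
  also have "\<dots> = g"
    using a by (metis Comp_assoc bar_simps)
  finally show ?thesis using a by simp
qed

lemma nat_le_Comp:
  assumes a: "nat_le X a a'" and b: "nat_le X b b'" and ab: "Dom X a' = Cod X b'"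
  shows "nat_le X (a \<cdot> b) (a' \<cdot> b')"
proof -
  have arr: "a' \<in> Arr X" "b' \<in> Arr X" using a b by (auto simp: nat_le_def)
  obtain e where e: "e \<in> idems X (Dom X a')" "a = a' \<cdot> e" using a by (rule nat_leE_right)
  obtain e' where e': "e' \<in> idems X (Dom X b')" "b = b' \<cdot> e'" using b by (rule nat_leE_right)
  note s = idems_simps[OF e(1)] idems_simps[OF e'(1)]
  have "nat_le X (e \<cdot> b') b'" using nat_leI_left[of b' e] e ab arr by simp
  then obtain d where d: "d \<in> idems X (Dom X b')" "e \<cdot> b' = b' \<cdot> d" by (rule nat_leE_right)
  note d' = idems_simps[OF d(1)]
  have "a \<cdot> b = a' \<cdot> (e \<cdot> b' \<cdot> e')" using arr e e' s ab by (simp add: comp_simps)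
  also have "\<dots> = a' \<cdot> b' \<cdot> (d \<cdot> e')" unfolding d(2) using arr s d' ab by (simp add: comp_simps)
  finally show ?thesis
    using nat_leI_right[of "a' \<cdot> b'" "d \<cdot> e'"] idems_Comp[OF d(1) e'(1)] arr ab
    by (simp add: comp_simps)
qed

lemma idems_le_iff:
  assumes "e \<in> idems X A" "f \<in> idems X B"
  shows "nat_le X e f \<longleftrightarrow> A = B \<and> e = f \<cdot> e"
  using idems_simps[OF assms(1)] idems_simps[OF assms(2)] by (auto simp: nat_le_def)

text \<open>
  The source of restrictions in \<open>\<G>(X)\<close>: with \<open>bar X f\<close> as the domain of \<open>f\<close>, the unique arrow below \<open>f\<close>
  with domain \<open>e\<close> is \<open>f \<cdot> e\<close>.
\<close>

lemma nat_le_restrict_iff: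
  assumes f: "f \<in> Arr X" and e: "e \<in> idems X (Dom X f)" and le: "nat_le X e (bar X f)"
  shows "nat_le X g f \<and> bar X g = e \<longleftrightarrow> g = f \<cdot> e"
proof
  note s = idems_simps[OF e]
  have e1: "e = bar X f \<cdot> e" using le e bar_in_idems[OF f] by (simp add: idems_le_iff)
  have "bar X (f \<cdot> e) = e \<cdot> (bar X f \<cdot> e)"
    using f s by (simp add: bar_def circ_Comp comp_simps)
  then have "bar X (f \<cdot> e) = e" using e1 s by simp
  then show "nat_le X g f \<and> bar X g = e" if "g = f \<cdot> e"
    using that nat_leI_right[OF f e] by simp
qed (auto simp: nat_le_def)

end

section \<open>Restriction and tensor product in ordered groupoids\<close>

context category
begin

lemma inverse_arrows_unique:
  assumes "inverse_arrows C f g" "inverse_arrows C f h"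
  shows "g = h"
proof -
  have a: "f \<in> Arr C" "g \<in> Arr C" "h \<in> Arr C" "Dom C g = Cod C f" "Cod C g = Dom C f"
    "Dom C h = Cod C f" "Cod C h = Dom C f" "g \<cdot> f = Ident C (Dom C f)" "f \<cdot> h = Ident C (Cod C f)"
    using assms by (auto simp: inverse_arrows_def)
  have "g = g \<cdot> (f \<cdot> h)" using a Comp_Ident[of g] by simp
  also have "\<dots> = g \<cdot> f \<cdot> h" by (rule Comp_assoc[symmetric]) (use a in simp_all)
  also have "\<dots> = h" using a Ident_Comp[of h] by simp
  finally show ?thesis .
qed

lemma inv_arrow_eqI: "inverse_arrows C f g \<Longrightarrow> inv_arrow C f = g"
  unfolding inv_arrow_def by (rule the_equality, assumption) (rule inverse_arrows_unique)

end

context ordered_groupoid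
begin

lemma inverse_arrows_inv:
  assumes "f \<in> Arr G"
  shows "inverse_arrows G f (inv_arrow G f)"
proof -
  obtain g where g: "inverse_arrows G f g"
    using groupoid[OF assms] by (auto simp: iso_arrow_def)
  from inv_arrow_eqI[OF g] g show ?thesis by simp
qed

lemma inv_simps:
  assumes "f \<in> Arr G"
  shows "inv_arrow G f \<in> Arr G" "Dom G (inv_arrow G f) = Cod G f" "Cod G (inv_arrow G f) = Dom G f"
    "inv_arrow G f \<cdot> f = Ident G (Dom G f)" "f \<cdot> inv_arrow G f = Ident G (Cod G f)"
    "inv_arrow G (inv_arrow G f) = f"
proof -
  show *: "inv_arrow G f \<in> Arr G" "Dom G (inv_arrow G f) = Cod G f" "Cod G (inv_arrow G f) = Dom G f"
    "inv_arrow G f \<cdot> f = Ident G (Dom G f)" "f \<cdot> inv_arrow G f = Ident G (Cod G f)"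
    using inverse_arrows_inv[OF assms] by (auto simp: inverse_arrows_def)
  show "inv_arrow G (inv_arrow G f) = f"
    using * assms by (intro inv_arrow_eqI) (simp add: inverse_arrows_def)
qed

lemma obj_le_refl: "A \<in> Obj G \<Longrightarrow> obj_le G A A"
  by (simp add: obj_le_def Le_refl Ident_in)

lemma obj_le_trans:
  "\<lbrakk>A \<in> Obj G; B \<in> Obj G; C \<in> Obj G; obj_le G A B; obj_le G B C\<rbrakk> \<Longrightarrow> obj_le G A C"
  using Le_trans[of "Ident G A" "Ident G B" "Ident G C"] by (simp add: obj_le_def Ident_in)

lemma obj_le_antisym: "\<lbrakk>A \<in> Obj G; B \<in> Obj G; obj_le G A B; obj_le G B A\<rbrakk> \<Longrightarrow> A = B"
proof -
  assume "A \<in> Obj G" "B \<in> Obj G" "obj_le G A B" "obj_le G B A"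
  then have "Dom G (Ident G A) = Dom G (Ident G B)"
    unfolding obj_le_def by (intro arg_cong[of _ _ "Dom G"] Le_antisym Ident_in)
  then show ?thesis using \<open>A \<in> Obj G\<close> \<open>B \<in> Obj G\<close> by (simp add: Dom_Ident)
qed

lemma obj_le_Dom: "\<lbrakk>f \<in> Arr G; g \<in> Arr G; Le G f g\<rbrakk> \<Longrightarrow> obj_le G (Dom G f) (Dom G g)"
  using Le_Comp[of "inv_arrow G f" f "inv_arrow G g" g] by (simp add: obj_le_def inv_simps Le_inv)

lemma obj_le_Cod: "\<lbrakk>f \<in> Arr G; g \<in> Arr G; Le G f g\<rbrakk> \<Longrightarrow> obj_le G (Cod G f) (Cod G g)"
  using Le_Comp[of f "inv_arrow G f" g "inv_arrow G g"] by (simp add: obj_le_def inv_simps Le_inv)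

lemma Le_eqI_Dom:
  assumes "f \<in> Arr G" "g \<in> Arr G" "h \<in> Arr G" "Le G g f" "Le G h f" "Dom G g = Dom G h"
  shows "g = h"
proof -
  have "\<exists>!k. k \<in> Arr G \<and> Le G k f \<and> Dom G k = Dom G g"
    using assms by (intro ex1_restr obj_le_Dom Dom_in)
  with assms show ?thesis by metis
qed

lemma Le_eqI_Cod:
  assumes "f \<in> Arr G" "g \<in> Arr G" "h \<in> Arr G" "Le G g f" "Le G h f" "Cod G g = Cod G h"
  shows "g = h"
proof -
  have "\<exists>!k. k \<in> Arr G \<and> Le G k f \<and> Cod G k = Cod G g"
    using assms by (intro ex1_corestr obj_le_Cod Cod_in)
  with assms show ?thesis by metis
qed

lemma restr_simps:
  assumes "f \<in> Arr G" "A \<in> Obj G" "obj_le G A (Dom G f)"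
  shows "restr G f A \<in> Arr G" "Le G (restr G f A) f" "Dom G (restr G f A) = A"
  using theI'[OF ex1_restr[OF assms]] unfolding restr_def by auto

lemma corestr_simps:
  assumes "f \<in> Arr G" "B \<in> Obj G" "obj_le G B (Cod G f)"
  shows "corestr G B f \<in> Arr G" "Le G (corestr G B f) f" "Cod G (corestr G B f) = B"
  using theI'[OF ex1_corestr[OF assms]] unfolding corestr_def by auto

lemma restr_eqI: "\<lbrakk>f \<in> Arr G; g \<in> Arr G; Le G g f; Dom G g = A\<rbrakk> \<Longrightarrow> restr G f A = g"
  unfolding restr_def by (rule the_equality, blast) (rule Le_eqI_Dom[of f], auto)

lemma corestr_eqI: "\<lbrakk>f \<in> Arr G; g \<in> Arr G; Le G g f; Cod G g = B\<rbrakk> \<Longrightarrow> corestr G B f = g"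
  unfolding corestr_def by (rule the_equality, blast) (rule Le_eqI_Cod[of f], auto)

lemma is_meet_unique: "\<lbrakk>K \<subseteq> Obj G; is_meet G K S m; is_meet G K S n\<rbrakk> \<Longrightarrow> m = n"
  unfolding is_meet_def by (rule obj_le_antisym) auto

lemma meet_eqI: "is_meet G (Obj G) {A, B} m \<Longrightarrow> meet G A B = m"
  unfolding meet_def by (rule the_equality, assumption) (rule is_meet_unique[OF subset_refl])

lemma is_meet_insert:
  assumes "is_meet G (Obj G) S m" "is_meet G (Obj G) {A, m} n"
  shows "is_meet G (Obj G) (insert A S) n"
proof -
  have S: "S \<subseteq> Obj G" "m \<in> Obj G" "\<And>B. B \<in> S \<Longrightarrow> obj_le G m B"
    "\<And>D. \<lbrakk>D \<in> Obj G; \<forall>B\<in>S. obj_le G D B\<rbrakk> \<Longrightarrow> obj_le G D m"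
    using assms(1) by (auto simp: is_meet_def)
  have n: "A \<in> Obj G" "n \<in> Obj G" "obj_le G n A" "obj_le G n m"
    "\<And>D. \<lbrakk>D \<in> Obj G; obj_le G D A; obj_le G D m\<rbrakk> \<Longrightarrow> obj_le G D n"
    using assms(2) by (auto simp: is_meet_def)
  have "obj_le G n B" if "B \<in> S" for B
    using obj_le_trans[OF n(2) S(2) _ n(4) S(3)[OF that]] S(1) that by blast
  then show ?thesis
    unfolding is_meet_def using S n by simp
qed

lemma is_meet_le: "\<lbrakk>A \<in> Obj G; B \<in> Obj G; obj_le G A B\<rbrakk> \<Longrightarrow> is_meet G (Obj G) {A, B} A"
  by (auto simp: is_meet_def obj_le_refl)

definition composite_below :: "'a \<Rightarrow> 'a \<Rightarrow> 'a \<Rightarrow> bool"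
where
  "composite_below f g x \<longleftrightarrow>
     (\<exists>f'\<in>Arr G. \<exists>g'\<in>Arr G. Le G f' f \<and> Le G g' g \<and> Dom G f' = Cod G g' \<and> x = f' \<cdot> g')"

lemma composite_belowI:
  "\<lbrakk>f' \<in> Arr G; g' \<in> Arr G; Le G f' f; Le G g' g; Dom G f' = Cod G g'\<rbrakk>
    \<Longrightarrow> composite_below f g (f' \<cdot> g')"
  unfolding composite_below_def by blast

lemma composite_belowE:
  assumes "composite_below f g x"
  obtains f' g' where "f' \<in> Arr G" "g' \<in> Arr G" "Le G f' f" "Le G g' g" "Dom G f' = Cod G g'"
    "x = f' \<cdot> g'"
  using assms unfolding composite_below_def by blast

lemma tensor_eq:
  assumes "f \<in> Arr G" "g \<in> Arr G" and m: "is_meet G (Obj G) {Dom G f, Cod G g} m"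
  shows "tensor G f g = restr G f m \<cdot> corestr G m g"
  by (simp add: tensor_def Let_def meet_eqI[OF m])

text \<open>
  The tensor product is the greatest composite below its factors, a description that no longer
  mentions meets. The domain of the left factor of a composite below \<open>f\<close> and \<open>g\<close> is a lower bound of
  \<open>Dom f\<close> and \<open>Cod g\<close>, hence lies below their meet, at which the tensor product is cut.
\<close>

lemma
  assumes f: "f \<in> Arr G" and g: "g \<in> Arr G" and m: "is_meet G (Obj G) {Dom G f, Cod G g} m"
  shows tensor_composite: "composite_below f g (tensor G f g)"
    and tensor_greatest: "composite_below f g x \<Longrightarrow> Le G x (tensor G f g)"
    and tensor_in: "tensor G f g \<in> Arr G"
proof -
  have m': "m \<in> Obj G" "obj_le G m (Dom G f)" "obj_le G m (Cod G g)"
    using m by (auto simp: is_meet_def)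
  note r = restr_simps[OF f m'(1,2)] and c = corestr_simps[OF g m'(1,3)]
  note t = tensor_eq[OF f g m]
  show "composite_below f g (tensor G f g)"
    unfolding t using r c by (intro composite_belowI) simp_all
  show "tensor G f g \<in> Arr G"
    unfolding t using r c by (simp add: Comp_in)
  assume "composite_below f g x"
  then obtain f' g' where x: "f' \<in> Arr G" "g' \<in> Arr G" "Le G f' f" "Le G g' g"
    "Dom G f' = Cod G g'" "x = f' \<cdot> g'"
    by (rule composite_belowE)
  let ?D = "Dom G f'"
  have D: "?D \<in> Obj G" "obj_le G ?D m"
    using m x f g obj_le_Dom[of f' f] obj_le_Cod[of g' g] Dom_in[of f']
    by (auto simp: is_meet_def)
  note r' = restr_simps[OF r(1) D(1)] and c' = corestr_simps[OF c(1) D(1)]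
  have "f' = restr G (restr G f m) ?D"
    using r r' D x f by (intro Le_eqI_Dom[of f]) (auto intro: Le_trans[of _ "restr G f m"])
  moreover have "g' = corestr G ?D (corestr G m g)"
    using c c' D x g by (intro Le_eqI_Cod[of g]) (auto intro: Le_trans[of _ "corestr G m g"])
  ultimately have "Le G f' (restr G f m)" "Le G g' (corestr G m g)"
    using r r' c c' D by auto
  then show "Le G x (tensor G f g)"
    unfolding t using x r c by (auto intro: Le_Comp)
qed

lemma tensor_Comp:
  assumes f: "f \<in> Arr G" and g: "g \<in> Arr G" and fg: "Dom G f = Cod G g"
  shows "tensor G f g = f \<cdot> g"
proof -
  have "is_meet G (Obj G) {Dom G f, Dom G f} (Dom G f)"
    using Dom_in[OF f] by (intro is_meet_le obj_le_refl)
  then have "is_meet G (Obj G) {Dom G f, Cod G g} (Dom G f)"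
    using fg by simp
  then show ?thesis
    using f g fg tensor_eq restr_eqI[of f f] corestr_eqI[of g g] Le_refl by simp
qed

text \<open>
  Restricting \<open>g\<close> to the domain of \<open>x\<close>, and then \<open>f\<close> to the codomain of the result, gives a composite
  below \<open>f \<cdot> g\<close> with the same domain as \<open>x\<close>; such an arrow is unique.
\<close>

lemma Le_Comp_split:
  assumes "f \<in> Arr G" "g \<in> Arr G" "Dom G f = Cod G g" "x \<in> Arr G" "Le G x (f \<cdot> g)"
  shows "composite_below f g x"
proof -
  have fg: "f \<cdot> g \<in> Arr G" "Dom G (f \<cdot> g) = Dom G g" using assms by (auto simp: Comp_in Dom_Comp)
  define g' where "g' = restr G g (Dom G x)"
  have g': "g' \<in> Arr G" "Le G g' g" "Dom G g' = Dom G x"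
    unfolding g'_def using assms fg obj_le_Dom[of x "f \<cdot> g"] Dom_in by (auto intro!: restr_simps)
  define f' where "f' = restr G f (Cod G g')"
  have f': "f' \<in> Arr G" "Le G f' f" "Dom G f' = Cod G g'"
    unfolding f'_def using assms g' obj_le_Cod[of g' g] Cod_in by (auto intro!: restr_simps)
  have "Le G (f' \<cdot> g') (f \<cdot> g)" "f' \<cdot> g' \<in> Arr G" "Dom G (f' \<cdot> g') = Dom G x"
    using f' g' assms by (auto intro: Le_Comp Comp_in simp: Dom_Comp)
  then have "x = f' \<cdot> g'" using assms fg by (intro Le_eqI_Dom[of "f \<cdot> g"]) auto
  then show ?thesis using composite_belowI[of f' g' f g] f' g' by simp
qed

end

definition block :: "('i, 'o, 'a, 'z) li_grpd_scheme \<Rightarrow> 'o \<Rightarrow> 'i"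
where
  "block G A = (THE i. i \<in> Ind G \<and> A \<in> Blk G i)"

context locally_inductive_groupoid
begin

lemma block_eqI: "\<lbrakk>i \<in> Ind G; A \<in> Blk G i\<rbrakk> \<Longrightarrow> block G A = i"
  unfolding block_def using Blk_disjoint by (blast intro: the_equality)

lemma block_in: "A \<in> Obj G \<Longrightarrow> block G A \<in> Ind G \<and> A \<in> Blk G (block G A)"
  using Blk_cover block_eqI by fastforce

lemma Blk_in_Obj: "i \<in> Ind G \<Longrightarrow> Blk G i \<subseteq> Obj G"
  using Blk_cover by auto

lemma block_le: "\<lbrakk>A \<in> Obj G; B \<in> Obj G; obj_le G A B\<rbrakk> \<Longrightarrow> block G A = block G B"
  using block_in Blk_comparable by blast

text \<open>
  The meet within the block is a meet among all objects, because a lower bound of objects of a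
  block is comparable to them and so belongs to that block.
\<close>

lemma ex_meet:
  assumes "A \<in> Obj G" "B \<in> Obj G" "block G A = block G B"
  shows "\<exists>m. is_meet G (Obj G) {A, B} m"
proof -
  let ?M = "Blk G (block G A)"
  have i: "block G A \<in> Ind G" "A \<in> ?M" "B \<in> ?M"
    using block_in[OF assms(1)] block_in[OF assms(2)] assms(3) by simp_all
  then obtain m where m: "is_meet G ?M {A, B} m" using Blk_semilattice by blast
  have "D \<in> ?M" if "D \<in> Obj G" "obj_le G D A" for D
    using block_in[OF that(1)] block_le[OF that(1) assms(1) that(2)] by simp
  then have "is_meet G (Obj G) {A, B} m"
    using m assms Blk_in_Obj[OF i(1)] unfolding is_meet_def by blast
  then show ?thesis ..
qed

lemma tensor_props:
  assumes f: "f \<in> Arr G" and g: "g \<in> Arr G" and fg: "block G (Dom G f) = block G (Cod G g)"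
  shows "tensor G f g \<in> Arr G" "composite_below f g (tensor G f g)"
    "composite_below f g x \<Longrightarrow> Le G x (tensor G f g)"
  using tensor_in[OF f g] tensor_composite[OF f g] tensor_greatest[OF f g]
    ex_meet[OF Dom_in[OF f] Cod_in[OF g] fg] by blast+

lemma tensorE:
  assumes f: "f \<in> Arr G" and g: "g \<in> Arr G" and fg: "block G (Dom G f) = block G (Cod G g)"
  obtains f' g' where "f' \<in> Arr G" "g' \<in> Arr G" "Le G f' f" "Le G g' g" "Dom G f' = Cod G g'"
    "tensor G f g = f' \<cdot> g'"
  using tensor_props(2)[OF assms] that by (rule composite_belowE)

lemma obj_le_Dom_tensor:
  assumes "f \<in> Arr G" "g \<in> Arr G" "block G (Dom G f) = block G (Cod G g)"
  shows "obj_le G (Dom G (tensor G f g)) (Dom G g)" "obj_le G (Cod G (tensor G f g)) (Cod G f)"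
  by (rule tensorE[OF assms], use assms in \<open>simp add: Dom_Comp Cod_Comp obj_le_Dom obj_le_Cod\<close>)+

lemma block_tensor:
  assumes "f \<in> Arr G" "g \<in> Arr G" "block G (Dom G f) = block G (Cod G g)"
  shows "block G (Dom G (tensor G f g)) = block G (Dom G g)"
    "block G (Cod G (tensor G f g)) = block G (Cod G f)"
  using obj_le_Dom_tensor[OF assms] tensor_props(1)[OF assms] assms
  by (simp_all add: block_le Dom_in Cod_in)

text \<open>
  Both bracketings are the greatest composite \<open>f' \<cdot> g' \<cdot> h'\<close> with \<open>f' \<le> f\<close>, \<open>g' \<le> g\<close>, \<open>h' \<le> h\<close>:
  an arrow below a composite \<open>f' \<cdot> g'\<close> splits into an arrow below \<open>f'\<close> and one below \<open>g'\<close>.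
\<close>

lemma tensor_assoc:
  assumes f: "f \<in> Arr G" and g: "g \<in> Arr G" and h: "h \<in> Arr G"
    and fg: "block G (Dom G f) = block G (Cod G g)" and gh: "block G (Dom G g) = block G (Cod G h)"
  shows "tensor G (tensor G f g) h = tensor G f (tensor G g h)"
proof -
  note 1 = tensor_props[OF f g fg] and 2 = tensor_props[OF g h gh]
  have gh': "block G (Dom G (tensor G f g)) = block G (Cod G h)"
    and fg': "block G (Dom G f) = block G (Cod G (tensor G g h))"
    using block_tensor[OF f g fg] block_tensor[OF g h gh] fg gh by simp_all
  note 3 = tensor_props[OF 1(1) h gh'] and 4 = tensor_props[OF f 2(1) fg']
  define P where "P x \<longleftrightarrow> (\<exists>f'\<in>Arr G. \<exists>g'\<in>Arr G. \<exists>h'\<in>Arr G. Le G f' f \<and> Le G g' g \<and> Le G h' h \<and>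
    Dom G f' = Cod G g' \<and> Dom G g' = Cod G h' \<and> x = f' \<cdot> g' \<cdot> h')" for x
  have P_I: "P (f' \<cdot> g' \<cdot> h')" if "f' \<in> Arr G" "g' \<in> Arr G" "h' \<in> Arr G" "Le G f' f" "Le G g' g"
    "Le G h' h" "Dom G f' = Cod G g'" "Dom G g' = Cod G h'" for f' g' h'
    unfolding P_def using that by blast
  have "composite_below (tensor G f g) h x \<longleftrightarrow> P x" for x
  proof
    assume "composite_below (tensor G f g) h x"
    then obtain k h' where k: "k \<in> Arr G" "Le G k (tensor G f g)" "h' \<in> Arr G" "Le G h' h"
      "Dom G k = Cod G h'" "x = k \<cdot> h'" by (rule composite_belowE)
    obtain f' g' where t: "f' \<in> Arr G" "g' \<in> Arr G" "Le G f' f" "Le G g' g" "Dom G f' = Cod G g'"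
      "tensor G f g = f' \<cdot> g'" by (rule tensorE[OF f g fg])
    have "composite_below f' g' k" using Le_Comp_split[of _ _ k] t k by simp
    then obtain f'' g'' where s: "f'' \<in> Arr G" "g'' \<in> Arr G" "Le G f'' f'" "Le G g'' g'"
      "Dom G f'' = Cod G g''" "k = f'' \<cdot> g''" by (rule composite_belowE)
    have "Le G f'' f" "Le G g'' g"
      using s t f g by (blast intro: Le_trans)+
    with s k show "P x" using P_I[of f'' g'' h'] by (simp add: Dom_Comp)
  next
    assume "P x"
    then obtain f' g' h' where x: "f' \<in> Arr G" "g' \<in> Arr G" "h' \<in> Arr G" "Le G f' f" "Le G g' g"
      "Le G h' h" "Dom G f' = Cod G g'" "Dom G g' = Cod G h'" "x = f' \<cdot> g' \<cdot> h'"
      unfolding P_def by blast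
    then have "Le G (f' \<cdot> g') (tensor G f g)" by (intro 1(3) composite_belowI)
    then show "composite_below (tensor G f g) h x"
      using x by (auto intro!: composite_belowI simp: Comp_in Dom_Comp)
  qed
  moreover have "composite_below f (tensor G g h) x \<longleftrightarrow> P x" for x
  proof
    assume "composite_below f (tensor G g h) x"
    then obtain f' k where k: "k \<in> Arr G" "Le G k (tensor G g h)" "f' \<in> Arr G" "Le G f' f"
      "Dom G f' = Cod G k" "x = f' \<cdot> k" by (rule composite_belowE)
    obtain g' h' where t: "g' \<in> Arr G" "h' \<in> Arr G" "Le G g' g" "Le G h' h" "Dom G g' = Cod G h'"
      "tensor G g h = g' \<cdot> h'" by (rule tensorE[OF g h gh])
    have "composite_below g' h' k" using Le_Comp_split[of _ _ k] t k by simp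
    then obtain g'' h'' where s: "g'' \<in> Arr G" "h'' \<in> Arr G" "Le G g'' g'" "Le G h'' h'"
      "Dom G g'' = Cod G h''" "k = g'' \<cdot> h''" by (rule composite_belowE)
    have "Le G g'' g" "Le G h'' h"
      using s t g h by (blast intro: Le_trans)+
    with s k show "P x" using P_I[of f' g'' h''] by (simp add: Cod_Comp Comp_assoc)
  next
    assume "P x"
    then obtain f' g' h' where x: "f' \<in> Arr G" "g' \<in> Arr G" "h' \<in> Arr G" "Le G f' f" "Le G g' g"
      "Le G h' h" "Dom G f' = Cod G g'" "Dom G g' = Cod G h'" "x = f' \<cdot> g' \<cdot> h'"
      unfolding P_def by blast
    then have "Le G (g' \<cdot> h') (tensor G g h)" by (intro 2(3) composite_belowI)
    then show "composite_below f (tensor G g h) x"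
      using x by (auto intro!: composite_belowI simp: Comp_in Cod_Comp Comp_assoc)
  qed
  ultimately have "Le G (tensor G (tensor G f g) h) (tensor G f (tensor G g h))"
    "Le G (tensor G f (tensor G g h)) (tensor G (tensor G f g) h)"
    using 3(2,3) 4(2,3) by simp_all
  with 3(1) 4(1) show ?thesis by (intro Le_antisym)
qed

end

section \<open>The locally inductive groupoid of an inverse semicategory\<close>

lemma G_obj_simps [simp]:
  "Obj (G_obj X) = (\<Union>A\<in>Obj X. idems X A)" "Arr (G_obj X) = Arr X" "Dom (G_obj X) = bar X"
  "Cod (G_obj X) f = bar X (circ X f)" "Comp (G_obj X) = Comp X" "Ident (G_obj X) e = e"
  "Le (G_obj X) = nat_le X" "Ind (G_obj X) = Obj X" "Blk (G_obj X) = idems X"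
  by (simp_all add: G_obj_def)

lemma obj_le_G_obj [simp]: "obj_le (G_obj X) = nat_le X"
  by (simp add: obj_le_def fun_eq_iff)

context
  fixes X :: "'u isc" (structure)
  assumes inverse: "inverse_semicategory X"
begin

interpretation inverse_semicategory X
  by (fact inverse)

lemma bar_eq_imp:
  assumes "f \<in> Arr X" "g \<in> Arr X" "bar X g = bar X (circ X f)"
  shows "Dom X g = Cod X f"
  using arg_cong[OF assms(3), of "Dom X"] assms(1,2) by simp

lemma bar_Comp:
  assumes f: "f \<in> Arr X" and g: "g \<in> Arr X" and gf: "bar X g = bar X (circ X f)"
  shows "bar X (g \<cdot> f) = bar X f"
proof -
  note d = bar_eq_imp[OF assms]
  have "bar X (g \<cdot> f) = circ X f \<cdot> (bar X g \<cdot> f)"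
    using f g d by (simp add: bar_def circ_Comp comp_simps)
  also have "\<dots> = bar X f"
    unfolding gf using f by (simp add: bar_def comp_simps)
  finally show ?thesis .
qed

lemma category_G_obj: "category (G_obj X)"
proof
  fix f g h
  assume f: "f \<in> Arr (G_obj X)"
  then have f': "f \<in> Arr X" by simp
  show "Dom (G_obj X) f \<in> Obj (G_obj X)" "Cod (G_obj X) f \<in> Obj (G_obj X)"
    using bar_in_idems[OF f'] bar_circ_in_idems[OF f'] Dom_in[OF f'] Cod_in[OF f'] by auto
  show "f \<cdot>\<^bsub>G_obj X\<^esub> Ident (G_obj X) (Dom (G_obj X) f) = f"
    "Ident (G_obj X) (Cod (G_obj X) f) \<cdot>\<^bsub>G_obj X\<^esub> f = f"
    using f' by (simp_all add: bar_def comp_simps)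
  assume g: "g \<in> Arr (G_obj X)" and gf: "Dom (G_obj X) g = Cod (G_obj X) f"
  then have g': "g \<in> Arr X" "bar X g = bar X (circ X f)" by simp_all
  note d = bar_eq_imp[OF f' g']
  show "g \<cdot>\<^bsub>G_obj X\<^esub> f \<in> Arr (G_obj X)"
    and "Dom (G_obj X) (g \<cdot>\<^bsub>G_obj X\<^esub> f) = Dom (G_obj X) f"
    and "Cod (G_obj X) (g \<cdot>\<^bsub>G_obj X\<^esub> f) = Cod (G_obj X) g"
    using f' g' d bar_Comp[OF f' g'] bar_Comp[of "circ X g" "circ X f"]
    by (simp_all add: Comp_in circ_Comp)
  assume h: "h \<in> Arr (G_obj X)" and hg: "Dom (G_obj X) h = Cod (G_obj X) g"
  then have h': "h \<in> Arr X" "bar X h = bar X (circ X g)" by simp_all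
  show "h \<cdot>\<^bsub>G_obj X\<^esub> g \<cdot>\<^bsub>G_obj X\<^esub> f = h \<cdot>\<^bsub>G_obj X\<^esub> (g \<cdot>\<^bsub>G_obj X\<^esub> f)"
    using f' g' h' d bar_eq_imp[OF g'(1) h'] by (simp add: Comp_assoc)
next
  fix e assume "e \<in> Obj (G_obj X)"
  then obtain A where "e \<in> idems X A" by auto
  from idems_simps[OF this]
  show "Ident (G_obj X) e \<in> Arr (G_obj X)" "Dom (G_obj X) (Ident (G_obj X) e) = e"
    "Cod (G_obj X) (Ident (G_obj X) e) = e"
    by simp_all
qed

lemma inverse_arrows_G_obj: "f \<in> Arr X \<Longrightarrow> inverse_arrows (G_obj X) f (circ X f)"
  by (simp add: inverse_arrows_def) (simp add: bar_def)

lemma inv_arrow_G_obj: "f \<in> Arr X \<Longrightarrow> inv_arrow (G_obj X) f = circ X f"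
  by (intro category.inv_arrow_eqI category_G_obj inverse_arrows_G_obj)

lemma ex1_restr_G_obj:
  assumes f: "f \<in> Arr X" and e: "e \<in> idems X A" and le: "nat_le X e (bar X f)"
  shows "\<exists>!g. g \<in> Arr X \<and> nat_le X g f \<and> bar X g = e"
proof -
  have "A = Dom X f"
    using le f idems_simps[OF e] by (auto simp: nat_le_def)
  then have e': "e \<in> idems X (Dom X f)" using e by simp
  have "g \<in> Arr X" if "nat_le X g f" for g using that by (simp add: nat_le_def)
  with nat_le_restrict_iff[OF f e' le] show ?thesis by metis
qed

text \<open>
  Taking pseudo-inverses preserves the order and exchanges domain and codomain, so corestrictions
  of \<open>f\<close> correspond to restrictions of \<open>circ X f\<close>.
\<close>

lemma ex1_corestr_G_obj:
  assumes f: "f \<in> Arr X" and e: "e \<in> idems X A" and le: "nat_le X e (bar X (circ X f))"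
  shows "\<exists>!g. g \<in> Arr X \<and> nat_le X g f \<and> bar X (circ X g) = e"
proof -
  obtain h where h: "h \<in> Arr X" "nat_le X h (circ X f)" "bar X h = e"
    and uniq: "\<And>k. \<lbrakk>k \<in> Arr X; nat_le X k (circ X f); bar X k = e\<rbrakk> \<Longrightarrow> k = h"
    using ex1_restr_G_obj[OF circ_simps(1)[OF f] e le] by blast
  show ?thesis
  proof (rule ex1I[of _ "circ X h"])
    show "circ X h \<in> Arr X \<and> nat_le X (circ X h) f \<and> bar X (circ X (circ X h)) = e"
      using h nat_le_circ[OF h(2)] f by simp
    fix g assume g: "g \<in> Arr X \<and> nat_le X g f \<and> bar X (circ X g) = e"
    then have "circ X g = h" by (intro uniq) (simp_all add: nat_le_circ)
    then show "g = circ X h" using g by auto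
  qed
qed

lemma ordered_groupoid_G_obj: "ordered_groupoid (G_obj X)"
proof (intro ordered_groupoid.intro category_G_obj ordered_groupoid_axioms.intro)
  fix f assume "f \<in> Arr (G_obj X)"
  then show "iso_arrow (G_obj X) f"
    using inverse_arrows_G_obj unfolding iso_arrow_def by auto
next
  fix f g assume "f \<in> Arr (G_obj X)" "g \<in> Arr (G_obj X)" "Le (G_obj X) f g"
  then show "Le (G_obj X) (inv_arrow (G_obj X) f) (inv_arrow (G_obj X) g)"
    by (simp add: inv_arrow_G_obj nat_le_circ)
next
  fix a b a' b'
  assume "a \<in> Arr (G_obj X)" "b \<in> Arr (G_obj X)" "a' \<in> Arr (G_obj X)" "b' \<in> Arr (G_obj X)"
    "Le (G_obj X) a a'" "Le (G_obj X) b b'" "Dom (G_obj X) a' = Cod (G_obj X) b'"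
  then show "Le (G_obj X) (a \<cdot>\<^bsub>G_obj X\<^esub> b) (a' \<cdot>\<^bsub>G_obj X\<^esub> b')"
    using bar_eq_imp[of b' a'] by (simp add: nat_le_Comp)
next
  fix f e assume f: "f \<in> Arr (G_obj X)" and e: "e \<in> Obj (G_obj X)"
  then obtain A where A: "e \<in> idems X A" by auto
  show "\<exists>!g. g \<in> Arr (G_obj X) \<and> Le (G_obj X) g f \<and> Dom (G_obj X) g = e"
    if "obj_le (G_obj X) e (Dom (G_obj X) f)"
    using ex1_restr_G_obj[OF _ A, of f] that f by simp
  show "\<exists>!g. g \<in> Arr (G_obj X) \<and> Le (G_obj X) g f \<and> Cod (G_obj X) g = e"
    if "obj_le (G_obj X) e (Cod (G_obj X) f)"
    using ex1_corestr_G_obj[OF _ A, of f] that f by simp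
qed (auto intro: nat_le_refl nat_le_trans nat_le_antisym)

text \<open>
  Blocks need meets within \<open>idems X A\<close>, tensor products and functors need meets among all objects;
  the set \<open>K\<close> covers both.
\<close>

lemma is_meet_idems:
  assumes e: "e \<in> idems X A" and f: "f \<in> idems X A"
    and K: "idems X A \<subseteq> K" "K \<subseteq> Obj (G_obj X)"
  shows "is_meet (G_obj X) K {e, f} (e \<cdot> f)"
proof -
  note ef = idems_Comp[OF e f] and s = idems_simps[OF e] idems_simps[OF f]
  have "nat_le X (e \<cdot> f) e" "nat_le X (e \<cdot> f) f"
    using s idems_le_iff[OF ef e] idems_le_iff[OF ef f]
    by (simp, simp add: idems_commute[OF e f])
  moreover have "nat_le X d (e \<cdot> f)" if d: "d \<in> K" "nat_le X d e" "nat_le X d f" for d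
  proof -
    obtain B where B: "d \<in> idems X B" using d(1) K by auto
    then have "B = A" "d = e \<cdot> d" "d = f \<cdot> d"
      using d idems_le_iff[OF B e] idems_le_iff[OF B f] by auto
    then show ?thesis
      using idems_le_iff[OF B ef] idems_simps[OF B] s by (simp add: Comp_assoc)
  qed
  ultimately show ?thesis
    using e f ef K by (auto simp: is_meet_def)
qed

lemma locally_inductive_G_obj:
  assumes "\<And>A. A \<in> Obj X \<Longrightarrow> idems X A \<noteq> {}"
  shows "locally_inductive_groupoid (G_obj X)"
proof (intro locally_inductive_groupoid.intro ordered_groupoid_G_obj
    locally_inductive_groupoid_axioms.intro)
  fix A e f assume "A \<in> Ind (G_obj X)" "e \<in> Blk (G_obj X) A" "f \<in> Blk (G_obj X) A"
  then show "\<exists>m. is_meet (G_obj X) (Blk (G_obj X) A) {e, f} m"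
    using is_meet_idems[of e A f "idems X A"] by auto
next
  fix A B :: 'u assume "A \<noteq> B"
  then show "Blk (G_obj X) A \<inter> Blk (G_obj X) B = {}"
    by (auto simp: idems_iff)
qed (use assms in \<open>auto simp: idems_le_iff\<close>)

end

definition G_fmap :: "'u isc \<Rightarrow> ('u, 'u, 'u, 'u) fmap \<Rightarrow> ('u, 'u, 'u, 'u) fmap"
where
  "G_fmap X F = \<lparr>omap = restrict (amap F) (Obj (G_obj X)), amap = amap F\<rparr>"

lemma fmap_extensional_G_fmap: "fmap_extensional X F \<Longrightarrow> fmap_extensional (G_obj X) (G_fmap X F)"
  by (simp add: fmap_extensional_def G_fmap_def)

context
  fixes X Y :: "'u isc" and F :: "('u, 'u, 'u, 'u) fmap"
  assumes X: "inverse_semicategory X" and Y: "inverse_semicategory Y" and F: "semifunctor X Y F"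
begin

interpretation X: inverse_semicategory X by (fact X)
interpretation Y: inverse_semicategory Y by (fact Y)

lemma semifunctor_simps:
  shows "A \<in> Obj X \<Longrightarrow> omap F A \<in> Obj Y"
    and "f \<in> Arr X \<Longrightarrow> amap F f \<in> Arr Y"
    and "f \<in> Arr X \<Longrightarrow> Dom Y (amap F f) = omap F (Dom X f)"
    and "f \<in> Arr X \<Longrightarrow> Cod Y (amap F f) = omap F (Cod X f)"
    and "\<lbrakk>f \<in> Arr X; g \<in> Arr X; Dom X g = Cod X f\<rbrakk>
      \<Longrightarrow> amap F (g \<cdot>\<^bsub>X\<^esub> f) = amap F g \<cdot>\<^bsub>Y\<^esub> amap F f"
  using F by (auto simp: semifunctor_def)

text \<open>Being a pseudo-inverse is an equational condition, so it is transported by \<open>F\<close>.\<close>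

lemma semifunctor_circ:
  assumes f: "f \<in> Arr X"
  shows "amap F (circ X f) = circ Y (amap F f)"
proof -
  have 1: "amap F f \<cdot>\<^bsub>Y\<^esub> (amap F (circ X f) \<cdot>\<^bsub>Y\<^esub> amap F f) = amap F f"
    using arg_cong[OF X.circ_simps(4)[OF f], of "amap F"] f
    by (simp add: semifunctor_simps X.comp_simps del: X.circ_simps(4,5))
  have 2: "amap F (circ X f) \<cdot>\<^bsub>Y\<^esub> (amap F f \<cdot>\<^bsub>Y\<^esub> amap F (circ X f)) = amap F (circ X f)"
    using arg_cong[OF X.circ_simps(5)[OF f], of "amap F"] f
    by (simp add: semifunctor_simps X.comp_simps del: X.circ_simps(4,5))
  show ?thesis
    using 1 2 f
    by (intro Y.circ_eqI[symmetric])
      (simp_all add: regular_pair_def semifunctor_simps Y.comp_simps)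
qed

lemma semifunctor_bar: "f \<in> Arr X \<Longrightarrow> amap F (bar X f) = bar Y (amap F f)"
  by (simp add: bar_def semifunctor_circ semifunctor_simps)

lemma semifunctor_idems:
  assumes "e \<in> idems X A"
  shows "amap F e \<in> idems Y (omap F A)"
  using X.idems_simps[OF assms] semifunctor_simps(5)[of e e] by (simp add: Y.idems_iff semifunctor_simps)

lemma semifunctor_nat_le: "nat_le X f g \<Longrightarrow> nat_le Y (amap F f) (amap F g)"
  by (auto simp: nat_le_def semifunctor_simps simp flip: semifunctor_bar)
    (metis X.bar_simps(1,3) semifunctor_simps(5))

text \<open>
  The meet of finitely many idempotents is their product, built up by binary products, and
  products are preserved.
\<close>

lemma semifunctor_finite_meet:
  assumes S: "finite S" "S \<noteq> {}" "S \<subseteq> idems X A" and A: "A \<in> Obj X"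
  shows "\<exists>m\<in>idems X A. is_meet (G_obj X) (Obj (G_obj X)) S m \<and>
    is_meet (G_obj Y) (Obj (G_obj Y)) (amap F ` S) (amap F m)"
  using S
proof (induction S rule: finite_ne_induct)
  interpret GX: ordered_groupoid "G_obj X" by (rule ordered_groupoid_G_obj[OF X])
  interpret GY: ordered_groupoid "G_obj Y" by (rule ordered_groupoid_G_obj[OF Y])
  have sub: "idems X A \<subseteq> Obj (G_obj X)" "idems Y (omap F A) \<subseteq> Obj (G_obj Y)"
    using A semifunctor_simps(1) by auto
  have *: "is_meet (G_obj X) (Obj (G_obj X)) {e, f} (e \<cdot>\<^bsub>X\<^esub> f)"
    "is_meet (G_obj Y) (Obj (G_obj Y)) {amap F e, amap F f} (amap F (e \<cdot>\<^bsub>X\<^esub> f))"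
    if ef: "e \<in> idems X A" "f \<in> idems X A" for e f
  proof -
    have "amap F (e \<cdot>\<^bsub>X\<^esub> f) = amap F e \<cdot>\<^bsub>Y\<^esub> amap F f"
      using X.idems_simps[OF ef(1)] X.idems_simps[OF ef(2)] by (simp add: semifunctor_simps)
    then show "is_meet (G_obj X) (Obj (G_obj X)) {e, f} (e \<cdot>\<^bsub>X\<^esub> f)"
      "is_meet (G_obj Y) (Obj (G_obj Y)) {amap F e, amap F f} (amap F (e \<cdot>\<^bsub>X\<^esub> f))"
      using is_meet_idems[OF X ef sub(1) subset_refl]
        is_meet_idems[OF Y semifunctor_idems[OF ef(1)] semifunctor_idems[OF ef(2)] sub(2) subset_refl]
      by (simp_all only:)
  qed
  {
    case (singleton e)
    then have e: "e \<in> idems X A" by simp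
    then show ?case
      using *[OF e e] X.idems_simps(4)[OF e] by (intro bexI[of _ e]) (simp_all only: image_insert
        image_empty insert_absorb2 simp_thms)
  next
    case (insert e S)
    then obtain m where m: "m \<in> idems X A" "is_meet (G_obj X) (Obj (G_obj X)) S m"
      "is_meet (G_obj Y) (Obj (G_obj Y)) (amap F ` S) (amap F m)" by auto
    have e: "e \<in> idems X A" using insert by simp
    show ?case
      using GX.is_meet_insert[OF m(2) *(1)[OF e m(1)]] GY.is_meet_insert[OF m(3) *(2)[OF e m(1)]]
        X.idems_Comp[OF e m(1)]
      by (intro bexI[of _ "e \<cdot>\<^bsub>X\<^esub> m"]) (simp_all only: image_insert simp_thms)
  }
qed

lemma locally_inductive_G_fmap: "locally_inductive_functor (G_obj X) (G_obj Y) (G_fmap X F)"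
  unfolding locally_inductive_functor_def ordered_functor_def cat_functor_def semifunctor_def
proof (intro conjI allI ballI impI)
  have omap: "omap (G_fmap X F) e = amap F e" if "e \<in> Obj (G_obj X)" for e
    using that by (simp add: G_fmap_def)
  show "omap (G_fmap X F) \<in> Obj (G_obj X) \<rightarrow> Obj (G_obj Y)"
    using semifunctor_idems semifunctor_simps(1) by (fastforce simp: omap)
  show "amap (G_fmap X F) \<in> Arr (G_obj X) \<rightarrow> Arr (G_obj Y)"
    by (simp add: G_fmap_def semifunctor_simps)
  fix e assume "e \<in> Obj (G_obj X)"
  then show "amap (G_fmap X F) (Ident (G_obj X) e) = Ident (G_obj Y) (omap (G_fmap X F) e)"
    by (simp add: G_fmap_def)
next
  fix f assume f: "f \<in> Arr (G_obj X)"
  have "bar X f \<in> Obj (G_obj X)" "bar X (circ X f) \<in> Obj (G_obj X)"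
    using f category.axioms(1)[OF category_G_obj[OF X]] semicategory.Dom_in semicategory.Cod_in
    by fastforce+
  then show "Dom (G_obj Y) (amap (G_fmap X F) f) = omap (G_fmap X F) (Dom (G_obj X) f)"
    "Cod (G_obj Y) (amap (G_fmap X F) f) = omap (G_fmap X F) (Cod (G_obj X) f)"
    using f by (simp_all add: G_fmap_def semifunctor_bar semifunctor_circ)
next
  fix f g assume "f \<in> Arr (G_obj X)" "g \<in> Arr (G_obj X)" "Dom (G_obj X) g = Cod (G_obj X) f"
  then show "amap (G_fmap X F) (g \<cdot>\<^bsub>G_obj X\<^esub> f) = amap (G_fmap X F) g \<cdot>\<^bsub>G_obj Y\<^esub> amap (G_fmap X F) f"
    using bar_eq_imp[OF X, of f g] by (simp add: G_fmap_def semifunctor_simps)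
next
  fix f g assume "Le (G_obj X) f g"
  then show "Le (G_obj Y) (amap (G_fmap X F) f) (amap (G_fmap X F) g)"
    by (simp add: G_fmap_def semifunctor_nat_le)
next
  interpret GX: ordered_groupoid "G_obj X" by (rule ordered_groupoid_G_obj[OF X])
  fix S m assume S: "finite S \<and> S \<noteq> {} \<and> is_meet (G_obj X) (Obj (G_obj X)) S m"
  then have m: "S \<subseteq> Obj (G_obj X)" "m \<in> Obj (G_obj X)" "\<And>e. e \<in> S \<Longrightarrow> nat_le X m e"
    by (auto simp: is_meet_def)
  then obtain A where A: "A \<in> Obj X" "m \<in> idems X A" by auto
  have "S \<subseteq> idems X A"
  proof
    fix e assume e: "e \<in> S"
    then obtain B where B: "e \<in> idems X B" using m(1) by auto
    then show "e \<in> idems X A" using m(3)[OF e] X.idems_le_iff[OF A(2) B] by simp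
  qed
  then obtain n where n: "is_meet (G_obj X) (Obj (G_obj X)) S n"
    "is_meet (G_obj Y) (Obj (G_obj Y)) (amap F ` S) (amap F n)"
    using semifunctor_finite_meet[of S A] S A by auto
  have "m = n" using GX.is_meet_unique[OF subset_refl] S n(1) by blast
  moreover have o: "omap (G_fmap X F) e = amap F e" if "e \<in> Obj (G_obj X)" for e
    using that by (simp add: G_fmap_def)
  moreover have "omap (G_fmap X F) ` S = amap F ` S"
    using m(1) by (intro image_cong refl o) blast
  ultimately show "is_meet (G_obj Y) (Obj (G_obj Y)) (omap (G_fmap X F) ` S) (omap (G_fmap X F) m)"
    using n(2) m(2) by simp
qed

end

section \<open>The inverse semicategory of a locally inductive groupoid\<close>

lemma I_obj_simps [simp]:
  "Obj (I_obj G) = Ind G" "Arr (I_obj G) = Arr G" "Dom (I_obj G) f = block G (Dom G f)"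
  "Cod (I_obj G) f = block G (Cod G f)" "Comp (I_obj G) = tensor G"
  by (simp_all add: I_obj_def block_def)

context
  fixes G :: "'u lig" (structure)
  assumes li: "locally_inductive_groupoid G"
begin

interpretation locally_inductive_groupoid G
  by (fact li)

lemma semicategory_I_obj: "semicategory (I_obj G)"
  by unfold_locales (simp_all add: block_in Dom_in Cod_in tensor_props block_tensor tensor_assoc)

text \<open>
  If \<open>f \<otimes> g \<otimes> h = f\<close>, then \<open>f\<close> is not cut down at all when the product is formed, so its domain
  lies below the codomain of \<open>g\<close>.
\<close>

lemma tensor_absorb_left:
  assumes f: "f \<in> Arr G" and g: "g \<in> Arr G" and h: "h \<in> Arr G"
    and fg: "block G (Dom G f) = block G (Cod G g)" and gh: "block G (Dom G g) = block G (Cod G h)"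
    and eq: "tensor G (tensor G f g) h = f"
  shows "obj_le G (Dom G f) (Cod G g)"
proof -
  obtain f' g' where t: "f' \<in> Arr G" "g' \<in> Arr G" "Le G f' f" "Le G g' g" "Dom G f' = Cod G g'"
    "tensor G f g = f' \<cdot> g'"
    by (rule tensorE[OF f g fg])
  note T = tensor_props(1)[OF f g fg]
  have "obj_le G (Cod G f) (Cod G (tensor G f g))"
    using obj_le_Dom_tensor(2)[OF T h] block_tensor[OF f g fg] gh eq by simp
  then have "Cod G f = Cod G f'"
    using t f obj_le_Cod[of f' f] by (intro obj_le_antisym) (simp_all add: Cod_in Cod_Comp)
  then have "f' = f" using Le_eqI_Cod[of f f' f] t f Le_refl by simp
  then show ?thesis using t g obj_le_Cod[of g' g] by simp
qed

lemma tensor_absorb_right: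
  assumes f: "f \<in> Arr G" and g: "g \<in> Arr G" and h: "h \<in> Arr G"
    and gf: "block G (Dom G g) = block G (Cod G f)" and hg: "block G (Dom G h) = block G (Cod G g)"
    and eq: "tensor G h (tensor G g f) = f"
  shows "obj_le G (Cod G f) (Dom G g)"
proof -
  obtain g' f' where t: "g' \<in> Arr G" "f' \<in> Arr G" "Le G g' g" "Le G f' f" "Dom G g' = Cod G f'"
    "tensor G g f = g' \<cdot> f'"
    by (rule tensorE[OF g f gf])
  note T = tensor_props(1)[OF g f gf]
  have "obj_le G (Dom G f) (Dom G (tensor G g f))"
    using obj_le_Dom_tensor(1)[OF h T] block_tensor[OF g f gf] hg eq by simp
  then have "Dom G f = Dom G f'"
    using t f obj_le_Dom[of f' f] by (intro obj_le_antisym) (simp_all add: Dom_in Dom_Comp)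
  then have "f' = f" using Le_eqI_Dom[of f f' f] t f Le_refl by simp
  then show ?thesis using t g obj_le_Dom[of g' g] by simp
qed

text \<open>
  By the two absorption lemmas, applied to \<open>f\<close> and to \<open>g\<close>, \<open>f \<otimes> g \<otimes> f = f\<close> and \<open>g \<otimes> f \<otimes> g = g\<close> force
  \<open>Dom f = Cod g\<close> and \<open>Cod f = Dom g\<close>. All the tensor products are then composites, and in a groupoid
  \<open>f \<cdot> g \<cdot> f = f\<close> leaves only \<open>g = f\<inverse>\<close>.
\<close>

lemma regular_pair_I_obj:
  assumes f: "f \<in> Arr G"
  shows "regular_pair (I_obj G) f g \<longleftrightarrow> g = inv_arrow G f"
proof
  assume "g = inv_arrow G f"
  then show "regular_pair (I_obj G) f g"
    using f Ident_Comp[of f] Ident_Comp[of g]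
    by (simp add: regular_pair_def inv_simps tensor_Comp Ident_in Dom_Ident Cod_Ident Dom_in Cod_in)
next
  assume "regular_pair (I_obj G) f g"
  then have g: "g \<in> Arr G"
    and b: "block G (Dom G g) = block G (Cod G f)" "block G (Dom G f) = block G (Cod G g)"
    and e: "tensor G (tensor G f g) f = f" "tensor G (tensor G g f) g = g"
    by (simp_all add: regular_pair_def)
  then have e': "tensor G f (tensor G g f) = f" "tensor G g (tensor G f g) = g"
    using f tensor_assoc[of f g f] tensor_assoc[of g f g] by simp_all
  have Dom: "Dom G f = Cod G g"
    using f g b e(1) e'(2) tensor_absorb_left[of f g f] tensor_absorb_right[of g f g]
    by (intro obj_le_antisym) (simp_all add: Dom_in Cod_in)
  have Cod: "Cod G f = Dom G g"
    using f g b e(2) e'(1) tensor_absorb_left[of g f g] tensor_absorb_right[of f g f]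
    by (intro obj_le_antisym) (simp_all add: Dom_in Cod_in)
  have fgf: "f \<cdot> (g \<cdot> f) = f"
    using e'(1) f g Dom Cod by (simp add: tensor_Comp Comp_in Cod_Comp)
  note i = inv_simps[OF f]
  have "g \<cdot> f = inv_arrow G f \<cdot> f \<cdot> (g \<cdot> f)"
    using f g Dom Cod i(4) Ident_Comp[of "g \<cdot> f"] by (simp add: Comp_in Cod_Comp)
  also have "\<dots> = inv_arrow G f \<cdot> (f \<cdot> (g \<cdot> f))"
    using f g Dom Cod i(1-3) by (simp add: Comp_assoc Comp_in Cod_Comp)
  also have "\<dots> = Ident G (Dom G f)"
    using i fgf by simp
  finally have gf: "g \<cdot> f = Ident G (Dom G f)" .
  have "f \<cdot> g = f \<cdot> g \<cdot> (f \<cdot> inv_arrow G f)"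
    using f g Dom Cod i(5) Comp_Ident[of "f \<cdot> g"] by (simp add: Comp_in Dom_Comp)
  also have "\<dots> = f \<cdot> (g \<cdot> f) \<cdot> inv_arrow G f"
    using f g Dom Cod i(1-3) by (simp add: Comp_assoc Comp_in Cod_Comp Dom_Comp)
  also have "\<dots> = Ident G (Cod G f)"
    using i fgf by simp
  finally have "f \<cdot> g = Ident G (Cod G f)" .
  with gf have "inverse_arrows G f g"
    using f g Dom Cod by (simp add: inverse_arrows_def)
  then show "g = inv_arrow G f" by (simp add: inv_arrow_eqI)
qed

lemma inverse_semicategory_I_obj: "inverse_semicategory (I_obj G)"
  by (intro inverse_semicategory.intro inverse_semicategory_axioms.intro semicategory_I_obj)
    (simp add: regular_pair_I_obj)

lemma circ_I_obj [simp]: "f \<in> Arr G \<Longrightarrow> circ (I_obj G) f = inv_arrow G f"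
  by (simp add: circ_def regular_pair_I_obj)

lemma bar_I_obj [simp]: "f \<in> Arr G \<Longrightarrow> bar (I_obj G) f = Ident G (Dom G f)"
  by (simp add: bar_def inv_simps tensor_Comp)

lemma idems_I_obj:
  assumes "i \<in> Ind G"
  shows "idems (I_obj G) i = Ident G ` Blk G i"
proof (intro equalityI subsetI)
  fix e assume "e \<in> idems (I_obj G) i"
  then obtain f where f: "f \<in> Arr G" "block G (Dom G f) = i" "e = bar (I_obj G) f"
    by (auto simp: idems_def)
  then show "e \<in> Ident G ` Blk G i"
    using block_in[OF Dom_in[OF f(1)]] by auto
next
  fix e assume "e \<in> Ident G ` Blk G i"
  then obtain A where A: "A \<in> Blk G i" "e = Ident G A" by blast
  then have "A \<in> Obj G" "block G A = i"
    using Blk_in_Obj[OF assms] block_eqI[OF assms] by auto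
  then show "e \<in> idems (I_obj G) i"
    unfolding idems_def using A(2)
    by (intro CollectI exI[of _ e]) (simp add: Ident_in Dom_Ident Cod_Ident)
qed

lemma Le_Ident:
  assumes A: "A \<in> Obj G" and e: "e \<in> Arr G" and le: "Le G e (Ident G A)"
  shows "e = Ident G (Dom G e)"
proof (rule Le_eqI_Dom[of "Ident G A"])
  show "Le G (Ident G (Dom G e)) (Ident G A)"
    using obj_le_Dom[OF e Ident_in[OF A] le] A by (simp add: obj_le_def Dom_Ident)
qed (use assms in \<open>simp_all add: Ident_in Dom_in Dom_Ident\<close>)

lemma nat_le_I_obj_tensor:
  "nat_le (I_obj G) f g \<longleftrightarrow> f \<in> Arr G \<and> g \<in> Arr G \<and> block G (Dom G f) = block G (Dom G g) \<and>
    block G (Cod G f) = block G (Cod G g) \<and> tensor G g (Ident G (Dom G f)) = f"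
proof (cases "f \<in> Arr G")
  case True
  show ?thesis
    unfolding nat_le_def I_obj_simps bar_I_obj[OF True]
    by (simp only: eq_commute[of f "tensor G g (Ident G (Dom G f))"])
qed (simp add: nat_le_def)

text \<open>
  In \<open>\<I>(G)\<close> the relation \<open>f \<le> g\<close> says that \<open>f\<close> is the tensor product of \<open>g\<close> with the identity at
  \<open>Dom f\<close>. This product is an arrow below \<open>g\<close>, and if \<open>f \<le> g\<close> in \<open>G\<close>, then its domain is that of \<open>f\<close>,
  so that it must be \<open>f\<close>.
\<close>

lemma nat_le_I_obj: "nat_le (I_obj G) f g \<longleftrightarrow> f \<in> Arr G \<and> g \<in> Arr G \<and> Le G f g"
proof (cases "f \<in> Arr G \<and> g \<in> Arr G")
  case True
  then have f: "f \<in> Arr G" and g: "g \<in> Arr G" by simp_all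
  let ?A = "Dom G f"
  define p where "p = tensor G g (Ident G ?A)"
  have A: "?A \<in> Obj G" using f by (rule Dom_in)
  note I = Ident_in[OF A] Dom_Ident[OF A] Cod_Ident[OF A]
  \<comment> \<open>Arrows below an identity are identities, so this product is a single arrow below \<open>g\<close>.\<close>
  have t_le: "Le G p g" if b: "block G (Dom G g) = block G ?A"
  proof -
    obtain g' e where t: "g' \<in> Arr G" "e \<in> Arr G" "Le G g' g" "Le G e (Ident G ?A)"
      "Dom G g' = Cod G e" "p = g' \<cdot> e"
      unfolding p_def
      by (rule tensorE[OF g I(1), unfolded I(3), OF b])
    obtain B where B: "B \<in> Obj G" "e = Ident G B"
      by (rule that[OF Dom_in[OF t(2)] Le_Ident[OF A t(2,4)]])
    then have "p = g'" using t(1,5,6) Comp_Ident[OF t(1)] by (simp add: Cod_Ident)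
    then show ?thesis using t by simp
  qed
  show ?thesis
  proof
    assume "nat_le (I_obj G) f g"
    then have "block G (Dom G g) = block G ?A" "p = f"
      by (simp_all add: nat_le_I_obj_tensor p_def)
    then show "f \<in> Arr G \<and> g \<in> Arr G \<and> Le G f g" using f g t_le by simp
  next
    assume "f \<in> Arr G \<and> g \<in> Arr G \<and> Le G f g"
    then have le: "Le G f g" by simp
    have b: "block G ?A = block G (Dom G g)" "block G (Cod G f) = block G (Cod G g)"
      using obj_le_Dom[OF f g le] obj_le_Cod[OF f g le] f g by (auto intro!: block_le Dom_in Cod_in)
    note t = tensor_props[OF g I(1), unfolded I(3), OF b(1)[symmetric], folded p_def]
    have "composite_below g (Ident G ?A) f"
      using composite_belowI[of f "Ident G ?A" g "Ident G ?A"] f le I Comp_Ident[OF f]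
      by (simp add: Le_refl)
    then have "Le G f p" by (rule t(3))
    then have "obj_le G ?A (Dom G p)" using f t(1) by (intro obj_le_Dom)
    moreover have "obj_le G (Dom G p) ?A"
      unfolding p_def using obj_le_Dom_tensor(1)[OF g I(1)] b(1) I by simp
    ultimately have "Dom G p = ?A"
      using f t(1) by (intro obj_le_antisym) (simp_all add: Dom_in)
    then have "p = f"
      by (rule Le_eqI_Dom[OF g t(1) f t_le[OF b(1)[symmetric]] le])
    then show "nat_le (I_obj G) f g"
      using f g b by (simp add: nat_le_I_obj_tensor p_def)
  qed
qed (auto simp: nat_le_I_obj_tensor)

end

definition I_fmap ::
  "'u lig \<Rightarrow> 'u lig \<Rightarrow> ('u, 'u, 'u, 'u) fmap \<Rightarrow> ('u, 'u, 'u, 'u) fmap"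
where
  "I_fmap G H F = \<lparr>omap = (\<lambda>i\<in>Ind G. THE j. j \<in> Ind H \<and> omap F ` Blk G i \<subseteq> Blk H j),
    amap = amap F\<rparr>"

lemma fmap_extensional_I_fmap: "fmap_extensional G F \<Longrightarrow> fmap_extensional (I_obj G) (I_fmap G H F)"
  by (simp add: fmap_extensional_def I_fmap_def)

context
  fixes G H :: "'u lig" and F :: "('u, 'u, 'u, 'u) fmap"
  assumes G: "locally_inductive_groupoid G" and H: "locally_inductive_groupoid H"
    and F: "locally_inductive_functor G H F"
begin

interpretation G: locally_inductive_groupoid G by (fact G)
interpretation H: locally_inductive_groupoid H by (fact H)

lemma li_functor_simps:
  shows "A \<in> Obj G \<Longrightarrow> omap F A \<in> Obj H"
    and "f \<in> Arr G \<Longrightarrow> amap F f \<in> Arr H"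
    and "f \<in> Arr G \<Longrightarrow> Dom H (amap F f) = omap F (Dom G f)"
    and "f \<in> Arr G \<Longrightarrow> Cod H (amap F f) = omap F (Cod G f)"
    and "\<lbrakk>f \<in> Arr G; g \<in> Arr G; Dom G g = Cod G f\<rbrakk>
      \<Longrightarrow> amap F (g \<cdot>\<^bsub>G\<^esub> f) = amap F g \<cdot>\<^bsub>H\<^esub> amap F f"
    and "A \<in> Obj G \<Longrightarrow> amap F (Ident G A) = Ident H (omap F A)"
    and "\<lbrakk>f \<in> Arr G; g \<in> Arr G; Le G f g\<rbrakk> \<Longrightarrow> Le H (amap F f) (amap F g)"
    and "\<lbrakk>finite S; S \<noteq> {}; is_meet G (Obj G) S m\<rbrakk> \<Longrightarrow> is_meet H (Obj H) (omap F ` S) (omap F m)"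
  using F
  by (auto simp: locally_inductive_functor_def ordered_functor_def cat_functor_def semifunctor_def)

lemma li_functor_obj_le:
  "\<lbrakk>A \<in> Obj G; B \<in> Obj G; obj_le G A B\<rbrakk> \<Longrightarrow> obj_le H (omap F A) (omap F B)"
  using li_functor_simps(7)[of "Ident G A" "Ident G B"]
  by (simp add: obj_le_def li_functor_simps(6) G.Ident_in)

text \<open>
  Two objects of a block have a meet, and its image lies below both of their images, so these belong
  to the same block. This is what makes the object part of \<open>\<I>(F)\<close> well defined.
\<close>

lemma block_omap:
  assumes A: "A \<in> Obj G" and B: "B \<in> Obj G" and AB: "block G A = block G B"
  shows "block H (omap F A) = block H (omap F B)"
proof -
  obtain m where m: "is_meet G (Obj G) {A, B} m" using G.ex_meet[OF assms] by blast
  then have m': "m \<in> Obj G" "obj_le G m A" "obj_le G m B" by (auto simp: is_meet_def)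
  have "block H (omap F m) = block H (omap F A)" "block H (omap F m) = block H (omap F B)"
    using m' A B by (auto intro!: H.block_le li_functor_obj_le li_functor_simps(1))
  then show ?thesis by simp
qed

lemma omap_I_fmap:
  assumes A: "A \<in> Obj G"
  shows "omap (I_fmap G H F) (block G A) = block H (omap F A)"
proof -
  let ?i = "block G A" and ?j = "block H (omap F A)"
  note i = G.block_in[OF A]
  have "(THE j. j \<in> Ind H \<and> omap F ` Blk G ?i \<subseteq> Blk H j) = ?j"
  proof (rule the_equality)
    have "omap F B \<in> Blk H ?j" if "B \<in> Blk G ?i" for B
    proof -
      have B: "B \<in> Obj G" "block G B = ?i"
        using that i G.Blk_in_Obj[of ?i] G.block_eqI[of ?i B] by auto
      then show ?thesis
        using H.block_in[OF li_functor_simps(1)[OF B(1)]] block_omap[OF A B(1)] by simp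
    qed
    then show "?j \<in> Ind H \<and> omap F ` Blk G ?i \<subseteq> Blk H ?j"
      using H.block_in[OF li_functor_simps(1)[OF A]] by auto
    fix j assume "j \<in> Ind H \<and> omap F ` Blk G ?i \<subseteq> Blk H j"
    then show "j = ?j" using i H.block_eqI[of j "omap F A"] by auto
  qed
  then show ?thesis using i by (simp add: I_fmap_def)
qed

text \<open>
  The tensor product is built from a meet of two objects and the restrictions to it. Meets are
  preserved by assumption, and restrictions because the image of a restriction has the two
  properties that characterise the restriction of the image.
\<close>

lemma li_functor_tensor:
  assumes f: "f \<in> Arr G" and g: "g \<in> Arr G" and fg: "block G (Dom G f) = block G (Cod G g)"
  shows "amap F (tensor G f g) = tensor H (amap F f) (amap F g)"
proof -
  obtain m where m: "is_meet G (Obj G) {Dom G f, Cod G g} m"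
    using G.ex_meet[OF G.Dom_in[OF f] G.Cod_in[OF g] fg] by blast
  have m': "m \<in> Obj G" "obj_le G m (Dom G f)" "obj_le G m (Cod G g)"
    using m by (auto simp: is_meet_def)
  note r = G.restr_simps[OF f m'(1,2)] and c = G.corestr_simps[OF g m'(1,3)]
  have "is_meet H (Obj H) {Dom H (amap F f), Cod H (amap F g)} (omap F m)"
    using li_functor_simps(8)[OF _ _ m] f g by (simp add: li_functor_simps)
  from H.tensor_eq[OF _ _ this]
  have "tensor H (amap F f) (amap F g)
      = restr H (amap F f) (omap F m) \<cdot>\<^bsub>H\<^esub> corestr H (omap F m) (amap F g)"
    using f g by (simp add: li_functor_simps)
  also have "restr H (amap F f) (omap F m) = amap F (restr G f m)"
    using r f by (intro H.restr_eqI) (simp_all add: li_functor_simps)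
  also have "corestr H (omap F m) (amap F g) = amap F (corestr G m g)"
    using c g by (intro H.corestr_eqI) (simp_all add: li_functor_simps)
  finally show ?thesis
    using r c by (simp add: G.tensor_eq[OF f g m] li_functor_simps)
qed

lemma semifunctor_I_fmap: "semifunctor (I_obj G) (I_obj H) (I_fmap G H F)"
  unfolding semifunctor_def
proof (intro conjI ballI impI)
  show "omap (I_fmap G H F) \<in> Obj (I_obj G) \<rightarrow> Obj (I_obj H)"
  proof
    fix i assume "i \<in> Obj (I_obj G)"
    then have i: "i \<in> Ind G" by simp
    then obtain A where "A \<in> Blk G i" using G.Blk_nonempty by blast
    with i have "A \<in> Obj G" "i = block G A" using G.Blk_in_Obj[OF i] G.block_eqI[OF i] by auto
    then show "omap (I_fmap G H F) i \<in> Obj (I_obj H)"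
      using omap_I_fmap H.block_in li_functor_simps(1) by simp
  qed
next
  show "amap (I_fmap G H F) \<in> Arr (I_obj G) \<rightarrow> Arr (I_obj H)"
    by (simp add: I_fmap_def li_functor_simps)
next
  fix f assume "f \<in> Arr (I_obj G)"
  then have f: "f \<in> Arr G" by simp
  show "Dom (I_obj H) (amap (I_fmap G H F) f) = omap (I_fmap G H F) (Dom (I_obj G) f)"
    using f omap_I_fmap[OF G.Dom_in[OF f]] by (simp add: I_fmap_def[of G H F] li_functor_simps)
  show "Cod (I_obj H) (amap (I_fmap G H F) f) = omap (I_fmap G H F) (Cod (I_obj G) f)"
    using f omap_I_fmap[OF G.Cod_in[OF f]] by (simp add: I_fmap_def[of G H F] li_functor_simps)
next
  fix f g assume "f \<in> Arr (I_obj G)" "g \<in> Arr (I_obj G)" "Dom (I_obj G) g = Cod (I_obj G) f"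
  then show "amap (I_fmap G H F) (g \<cdot>\<^bsub>I_obj G\<^esub> f)
      = amap (I_fmap G H F) g \<cdot>\<^bsub>I_obj H\<^esub> amap (I_fmap G H F) f"
    by (simp add: I_fmap_def li_functor_tensor)
qed

end

section \<open>The two functors\<close>

abbreviation inverse_semicategories :: "'u isc set"
where
  "inverse_semicategories \<equiv> {X. inverse_semicategory X \<and> (\<forall>A\<in>Obj X. idems X A \<noteq> {})}"

abbreviation li_groupoids :: "'u lig set"
where
  "li_groupoids \<equiv> {G. locally_inductive_groupoid G}"

lemma isCat_concrete: "isCat = concrete_cat inverse_semicategories semifunctor"
  by (simp add: isCat_def concrete_cat_def Let_def)

lemma liGrpd_concrete: "liGrpd = concrete_cat li_groupoids locally_inductive_functor"
  by (simp add: liGrpd_def concrete_cat_def Let_def)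

lemma concrete_category_isCat:
  "concrete_category (inverse_semicategories :: 'u isc set) semifunctor"
proof
  fix X Y :: "'u isc" and F assume F: "semifunctor X Y F"
  show "omap F A \<in> Obj Y" if "A \<in> Obj X" for A using F that by (auto simp: semifunctor_def)
  show "amap F f \<in> Arr Y" if "f \<in> Arr X" for f using F that by (auto simp: semifunctor_def)
  show "semifunctor X Z (fmap_comp X K F)"
    if "X \<in> inverse_semicategories" "semifunctor Y Z K" for Z K
    using semifunctor_comp[OF F that(2)] that(1) by (simp add: inverse_semicategory_def)
qed (simp add: semifunctor_id inverse_semicategory_def)

lemma li_functor_id:
  fixes G :: "'u lig"
  assumes "locally_inductive_groupoid G"
  shows "locally_inductive_functor G G (fmap_id G)"
proof -
  interpret locally_inductive_groupoid G by (fact assms)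
  have "omap (fmap_id G) ` S = S" if "S \<subseteq> Obj G" for S
    using that by (auto simp: subset_iff image_iff)
  moreover have "S \<subseteq> Obj G" "m \<in> Obj G" if "is_meet G (Obj G) S m" for S m
    using that by (auto simp: is_meet_def)
  ultimately have "is_meet G (Obj G) (omap (fmap_id G) ` S) (omap (fmap_id G) m)"
    if "is_meet G (Obj G) S m" for S m
    using that by simp
  then show ?thesis
    using semifunctor_id[OF semicategory_axioms]
    by (simp add: locally_inductive_functor_def ordered_functor_def cat_functor_def Ident_in)
qed

lemma li_functor_comp:
  fixes G H K :: "'u lig"
  assumes G: "locally_inductive_groupoid G" and H: "locally_inductive_groupoid H"
    and K: "locally_inductive_groupoid K"
    and F: "locally_inductive_functor G H F" and L: "locally_inductive_functor H K L"
  shows "locally_inductive_functor G K (fmap_comp G L F)"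
proof -
  interpret G: locally_inductive_groupoid G by (fact G)
  note f = li_functor_simps[OF G H F] and l = li_functor_simps[OF H K L]
  have "semifunctor G K (fmap_comp G L F)"
    using semifunctor_comp[OF _ _ G.semicategory_axioms] F L
    by (auto simp: locally_inductive_functor_def ordered_functor_def cat_functor_def)
  moreover have "is_meet K (Obj K) (omap (fmap_comp G L F) ` S) (omap (fmap_comp G L F) m)"
    if S: "finite S" "S \<noteq> {}" "is_meet G (Obj G) S m" for S m
  proof -
    have s: "S \<subseteq> Obj G" "m \<in> Obj G" using S by (auto simp: is_meet_def)
    have "omap (fmap_comp G L F) ` S = omap L ` omap F ` S"
      unfolding image_image using s by (intro image_cong) auto
    then show ?thesis
      using l(8)[OF _ _ f(8)[OF S]] S s by simp
  qed
  ultimately show ?thesis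
    using f l by (simp add: locally_inductive_functor_def ordered_functor_def cat_functor_def G.Ident_in)
qed

lemma concrete_category_liGrpd:
  "concrete_category (li_groupoids :: 'u lig set) locally_inductive_functor"
proof
  fix G H :: "'u lig" and F assume F: "locally_inductive_functor G H F"
  then have "semifunctor G H F"
    by (simp add: locally_inductive_functor_def ordered_functor_def cat_functor_def)
  then show "omap F A \<in> Obj H" if "A \<in> Obj G" for A using that by (auto simp: semifunctor_def)
  show "amap F f \<in> Arr H" if "f \<in> Arr G" for f
    using \<open>semifunctor G H F\<close> that by (auto simp: semifunctor_def)
  show "locally_inductive_functor G K (fmap_comp G L F)"
    if "G \<in> li_groupoids" "H \<in> li_groupoids" "K \<in> li_groupoids" "locally_inductive_functor H K L"
    for K :: "'u lig" and L
    using li_functor_comp[OF _ _ _ F that(4)] that by simp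
qed (simp add: li_functor_id)

lemma G_obj_in: "X \<in> inverse_semicategories \<Longrightarrow> G_obj X \<in> li_groupoids"
  by (simp add: locally_inductive_G_obj)

lemma I_obj_in:
  assumes "G \<in> li_groupoids"
  shows "I_obj G \<in> inverse_semicategories"
proof -
  have G: "locally_inductive_groupoid G" using assms by simp
  then show ?thesis
    using locally_inductive_groupoid.Blk_nonempty[OF G]
    by (simp add: inverse_semicategory_I_obj idems_I_obj)
qed

lemma G_functor_cat_functor: "cat_functor isCat liGrpd G_functor"
proof -
  have G_functor: "G_functor = \<lparr>omap = G_obj, amap = (\<lambda>(X, Y, F). (G_obj X, G_obj Y, G_fmap X F))\<rparr>"
    by (simp add: G_functor_def G_fmap_def)
  show ?thesis
    unfolding isCat_concrete liGrpd_concrete G_functor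
  proof (rule concrete_cat_functorI[OF concrete_category_isCat concrete_category_liGrpd])
    fix X :: "'a isc" assume X: "X \<in> inverse_semicategories"
    then show "G_obj X \<in> li_groupoids" by (rule G_obj_in)
    interpret inverse_semicategory X using X by simp
    have "e \<in> Arr X" if "e \<in> Obj (G_obj X)" for e using that by (auto simp: idems_iff)
    then show "G_fmap X (fmap_id X) = fmap_id (G_obj X)"
      by (intro fmap_eqI[of "G_obj X"] fmap_extensional_G_fmap)
        (auto simp: G_fmap_def simp del: G_obj_simps(1) simp: G_obj_simps(2))
  next
    fix X Y :: "'a isc" and F
    assume "X \<in> inverse_semicategories" "Y \<in> inverse_semicategories" "semifunctor X Y F"
      "fmap_extensional X F"
    then show "locally_inductive_functor (G_obj X) (G_obj Y) (G_fmap X F) \<and>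
        fmap_extensional (G_obj X) (G_fmap X F)"
      by (simp add: locally_inductive_G_fmap fmap_extensional_G_fmap)
  next
    fix X Y Z :: "'a isc" and F L
    assume X: "X \<in> inverse_semicategories" and Y: "Y \<in> inverse_semicategories"
      and F: "semifunctor X Y F"
    interpret X: inverse_semicategory X using X by simp
    have e: "e \<in> Arr X \<and> amap F e \<in> Obj (G_obj Y)" if e: "e \<in> Obj (G_obj X)" for e
    proof -
      obtain A where A: "A \<in> Obj X" "e \<in> idems X A" using e by auto
      then show ?thesis
        using X Y F semifunctor_idems[of X Y F e A] semifunctor_simps(1)[of X Y F A] X.idems_simps(1)
        by auto
    qed
    show "G_fmap X (fmap_comp X L F) = fmap_comp (G_obj X) (G_fmap Y L) (G_fmap X F)"
    proof (rule fmap_eqI[of "G_obj X"])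
      fix e assume "e \<in> Obj (G_obj X)"
      with e[OF this] show "omap (G_fmap X (fmap_comp X L F)) e
          = omap (fmap_comp (G_obj X) (G_fmap Y L) (G_fmap X F)) e"
        by (simp add: G_fmap_def del: G_obj_simps(1))
    qed (simp_all add: fmap_extensional_G_fmap, simp add: G_fmap_def)
  qed
qed

lemma ex_block:
  assumes "locally_inductive_groupoid G" "i \<in> Ind G"
  obtains A where "A \<in> Obj G" "i = block G A"
proof -
  interpret locally_inductive_groupoid G by (fact assms)
  obtain A where A: "A \<in> Blk G i" using Blk_nonempty[OF assms(2)] by blast
  show thesis
    using that[of A] A Blk_in_Obj[OF assms(2)] block_eqI[OF assms(2) A] by auto
qed

lemma I_functor_cat_functor: "cat_functor liGrpd isCat I_functor"
proof -
  have I_functor: "I_functor = \<lparr>omap = I_obj, amap = (\<lambda>(G, H, F). (I_obj G, I_obj H, I_fmap G H F))\<rparr>"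
    by (simp add: I_functor_def I_fmap_def)
  show ?thesis
    unfolding isCat_concrete liGrpd_concrete I_functor
  proof (rule concrete_cat_functorI[OF concrete_category_liGrpd concrete_category_isCat])
    fix G :: "'a lig" assume "G \<in> li_groupoids"
    then show "I_obj G \<in> inverse_semicategories" by (rule I_obj_in)
    have G: "locally_inductive_groupoid G" using \<open>G \<in> li_groupoids\<close> by simp
    show "I_fmap G G (fmap_id G) = fmap_id (I_obj G)"
    proof (rule fmap_eqI[of "I_obj G"])
      fix i assume i: "i \<in> Obj (I_obj G)"
      then have "i \<in> Ind G" by simp
      then obtain A where "A \<in> Obj G" "i = block G A" by (rule ex_block[OF G])
      then show "omap (I_fmap G G (fmap_id G)) i = omap (fmap_id (I_obj G)) i"
        using i omap_I_fmap[OF G G li_functor_id[OF G]] by simp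
    qed (simp_all add: fmap_extensional_I_fmap, simp add: I_fmap_def)
  next
    fix G H :: "'a lig" and F
    assume "G \<in> li_groupoids" "H \<in> li_groupoids" "locally_inductive_functor G H F"
      "fmap_extensional G F"
    then show "semifunctor (I_obj G) (I_obj H) (I_fmap G H F) \<and>
        fmap_extensional (I_obj G) (I_fmap G H F)"
      by (simp add: semifunctor_I_fmap fmap_extensional_I_fmap)
  next
    fix G H K :: "'a lig" and F L
    assume *: "G \<in> li_groupoids" "H \<in> li_groupoids" "K \<in> li_groupoids"
      and F: "locally_inductive_functor G H F" and L: "locally_inductive_functor H K L"
    then have G: "locally_inductive_groupoid G" and H: "locally_inductive_groupoid H"
      and K: "locally_inductive_groupoid K" by simp_all
    show "I_fmap G K (fmap_comp G L F) = fmap_comp (I_obj G) (I_fmap H K L) (I_fmap G H F)"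
    proof (rule fmap_eqI[of "I_obj G"])
      fix i assume i: "i \<in> Obj (I_obj G)"
      then have "i \<in> Ind G" by simp
      then obtain A where A: "A \<in> Obj G" "i = block G A" by (rule ex_block[OF G])
      show "omap (I_fmap G K (fmap_comp G L F)) i
          = omap (fmap_comp (I_obj G) (I_fmap H K L) (I_fmap G H F)) i"
        using i A omap_I_fmap[OF G K li_functor_comp[OF G H K F L] A(1)] omap_I_fmap[OF G H F A(1)]
          omap_I_fmap[OF H K L li_functor_simps(1)[OF G H F A(1)]]
        by simp
    qed (simp_all add: fmap_extensional_I_fmap, simp add: I_fmap_def)
  qed
qed

section \<open>The unit and the counit\<close>

text \<open>
  The meet \<open>m\<close> of \<open>bar X g\<close> and \<open>bar X (circ X f)\<close> is their product, restriction and corestriction to \<open>m\<close>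
  are multiplication by \<open>m\<close>, and in \<open>g \<cdot> m \<cdot> m \<cdot> f\<close> the two factors of \<open>m\<close> are absorbed by \<open>g\<close> and \<open>f\<close>.
\<close>

lemma tensor_G_obj:
  fixes X :: "'u isc" (structure)
  assumes X: "inverse_semicategory X"
    and f: "f \<in> Arr X" and g: "g \<in> Arr X" and gf: "Dom X g = Cod X f"
  shows "tensor (G_obj X) g f = g \<cdot> f"
proof -
  interpret inverse_semicategory X by (fact X)
  interpret GX: ordered_groupoid "G_obj X" by (rule ordered_groupoid_G_obj[OF X])
  define e where "e = bar X g"
  define d where "d = bar X (circ X f)"
  have e: "e \<in> idems X (Dom X g)" and d: "d \<in> idems X (Dom X g)"
    using bar_in_idems[OF g] bar_circ_in_idems[OF f] gf by (simp_all add: e_def d_def)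
  define m where "m = e \<cdot> d"
  have m: "m \<in> idems X (Dom X g)" unfolding m_def by (rule idems_Comp[OF e d])
  have sub: "idems X (Dom X g) \<subseteq> Obj (G_obj X)" using Dom_in[OF g] by auto
  have meet: "is_meet (G_obj X) (Obj (G_obj X)) {e, d} m"
    unfolding m_def using is_meet_idems[OF X e d sub] by blast
  have le: "nat_le X m (bar X g)" "nat_le X m (bar X (circ X f))"
    using meet by (auto simp: is_meet_def e_def d_def)
  have r: "restr (G_obj X) g m = g \<cdot> m"
    using nat_le_restrict_iff[OF g m le(1), of "g \<cdot> m"] g idems_simps[OF m]
    by (intro GX.restr_eqI) (simp_all add: Comp_in)
  have "nat_le X (m \<cdot> f) f" "bar X (circ X (m \<cdot> f)) = m"
    using nat_leI_left[OF f, of m] nat_le_restrict_iff[OF _ _ le(2), of "circ X f \<cdot> m"] f m gf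
      idems_simps[OF m]
    by (simp_all add: circ_Comp)
  then have c: "corestr (G_obj X) m f = m \<cdot> f"
    using f gf idems_simps[OF m] by (intro GX.corestr_eqI) (simp_all add: Comp_in)
  have "tensor (G_obj X) g f = (g \<cdot> m) \<cdot> (m \<cdot> f)"
    using GX.tensor_eq[of g f m] f g meet r c by (simp add: e_def d_def)
  also have "\<dots> = g \<cdot> (e \<cdot> (d \<cdot> f))"
    using f g gf idems_simps[OF m] idems_simps[OF e] idems_simps[OF d]
    by (simp add: comp_simps m_def)
  also have "\<dots> = g \<cdot> f"
    using f g gf by (simp add: e_def d_def bar_def comp_simps circ_cancel)
  finally show ?thesis .
qed

text \<open>
  On objects, arrows and composable pairs \<open>\<I>(\<G>(X))\<close> agrees with \<open>X\<close>. The two records may still differ,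
  since their operations have arbitrary values elsewhere; this is why the unit is the identity map
  between two structures that need not be equal.
\<close>

lemma
  fixes X :: "'u isc"
  assumes X: "X \<in> inverse_semicategories"
  shows semifunctor_unit: "semifunctor X (I_obj (G_obj X)) (fmap_id X)"
    and semifunctor_unit_inverse: "semifunctor (I_obj (G_obj X)) X (fmap_id (I_obj (G_obj X)))"
    and block_G_obj: "\<And>e A. \<lbrakk>A \<in> Obj X; e \<in> idems X A\<rbrakk> \<Longrightarrow> block (G_obj X) e = A"
proof -
  have X': "inverse_semicategory X" using X by simp
  interpret inverse_semicategory X by (fact X')
  have "locally_inductive_groupoid (G_obj X)" using X by (simp add: locally_inductive_G_obj)
  from locally_inductive_groupoid.block_eqI[OF this]
  show b: "block (G_obj X) e = A" if "A \<in> Obj X" "e \<in> idems X A" for e A using that by simp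
  have "block (G_obj X) (bar X f) = Dom X f" "block (G_obj X) (bar X (circ X f)) = Cod X f"
    if "f \<in> Arr X" for f
    using that bar_in_idems[OF that] bar_circ_in_idems[OF that] Dom_in Cod_in b by blast+
  then show "semifunctor X (I_obj (G_obj X)) (fmap_id X)"
    "semifunctor (I_obj (G_obj X)) X (fmap_id (I_obj (G_obj X)))"
    by (auto simp: semifunctor_def Dom_in Cod_in Comp_in tensor_G_obj[OF X'])
qed

text \<open>
  Only the objects need an argument for naturality: \<open>\<I>(\<G>(F))\<close> recovers the image of an object \<open>A\<close> as
  the block into which the idempotents at \<open>A\<close> are sent.
\<close>

lemma natural_isomorphism_unit:
  "natural_isomorphism (isCat :: ('u isc, ('u isc, 'u) arrow) cat) isCat (fmap_id isCat)
    (fmap_comp isCat I_functor G_functor) (\<lambda>X. (X, I_obj (G_obj X), fmap_id X))"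
  unfolding natural_isomorphism_def
proof (intro conjI ballI)
  fix X :: "'u isc" assume "X \<in> Obj isCat"
  then have X: "X \<in> inverse_semicategories" by (simp add: isCat_concrete concrete_cat_def)
  have IGX: "I_obj (G_obj X) \<in> inverse_semicategories"
    by (intro I_obj_in G_obj_in X)
  show "(X, I_obj (G_obj X), fmap_id X) \<in> Arr isCat"
    "Dom isCat (X, I_obj (G_obj X), fmap_id X) = omap (fmap_id isCat) X"
    "Cod isCat (X, I_obj (G_obj X), fmap_id X) = omap (fmap_comp isCat I_functor G_functor) X"
    using X IGX semifunctor_unit[OF X] \<open>X \<in> Obj isCat\<close>
    by (simp_all add: isCat_concrete concrete_cat_def G_functor_def I_functor_def)
  show "iso_arrow isCat (X, I_obj (G_obj X), fmap_id X)"
    unfolding isCat_concrete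
    by (rule concrete_category.iso_arrowI[OF concrete_category_isCat X IGX semifunctor_unit[OF X] _
          semifunctor_unit_inverse[OF X]]) simp_all
next
  fix \<phi> :: "('u isc, 'u) arrow" assume phi: "\<phi> \<in> Arr isCat"
  then obtain X Y F where \<phi>: "\<phi> = (X, Y, F)" and X: "X \<in> inverse_semicategories"
    and Y: "Y \<in> inverse_semicategories" and F: "semifunctor X Y F"
    by (auto simp: isCat_concrete concrete_cat_def)
  have X': "inverse_semicategory X" and Y': "inverse_semicategory Y" using X Y by simp_all
  note li = locally_inductive_G_fmap[OF X' Y' F]
  have "fmap_comp X (I_fmap (G_obj X) (G_obj Y) (G_fmap X F)) (fmap_id X)
      = fmap_comp X (fmap_id Y) F"
  proof (rule fmap_eqI[of X])
    fix A assume A: "A \<in> Obj X"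
    then obtain e where e: "e \<in> idems X A" using X by blast
    then have eO: "e \<in> Obj (G_obj X)" using A by auto
    have "omap (I_fmap (G_obj X) (G_obj Y) (G_fmap X F)) (block (G_obj X) e)
        = block (G_obj Y) (omap (G_fmap X F) e)"
      using X Y by (intro omap_I_fmap[OF _ _ li eO]) (simp_all add: locally_inductive_G_obj)
    also have "omap (G_fmap X F) e = amap F e" using eO by (simp add: G_fmap_def)
    also have "block (G_obj Y) (amap F e) = omap F A"
      using block_G_obj[OF Y] semifunctor_simps(1)[OF X' Y' F A] semifunctor_idems[OF X' Y' F e]
      by blast
    finally show "omap (fmap_comp X (I_fmap (G_obj X) (G_obj Y) (G_fmap X F)) (fmap_id X)) A
        = omap (fmap_comp X (fmap_id Y) F) A"
      using A block_G_obj[OF X A e] semifunctor_simps(1)[OF X' Y' F A] by simp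
  qed (simp_all add: I_fmap_def G_fmap_def semifunctor_simps[OF X' Y' F])
  moreover have "amap (fmap_comp isCat I_functor G_functor) \<phi>
      = (I_obj (G_obj X), I_obj (G_obj Y), I_fmap (G_obj X) (G_obj Y) (G_fmap X F))"
    using phi by (simp add: \<phi> G_functor_def I_functor_def G_fmap_def I_fmap_def)
  moreover have "amap (fmap_id isCat) \<phi> = \<phi>" using phi by simp
  ultimately show "amap (fmap_comp isCat I_functor G_functor) \<phi> \<cdot>\<^bsub>isCat\<^esub>
      (Dom isCat \<phi>, I_obj (G_obj (Dom isCat \<phi>)), fmap_id (Dom isCat \<phi>))
    = (Cod isCat \<phi>, I_obj (G_obj (Cod isCat \<phi>)), fmap_id (Cod isCat \<phi>)) \<cdot>\<^bsub>isCat\<^esub>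
      amap (fmap_id isCat) \<phi>"
    by (simp add: \<phi> isCat_concrete concrete_cat_def)
qed

text \<open>
  A surjection that preserves and reflects the order of objects carries greatest lower bounds to
  greatest lower bounds.
\<close>

lemma li_functor_order_isoI:
  fixes G H :: "'u lig"
  assumes G: "ordered_groupoid G" and F: "ordered_functor G H F"
    and surj: "omap F ` Obj G = Obj H"
    and refl: "\<And>A B. \<lbrakk>A \<in> Obj G; B \<in> Obj G; obj_le H (omap F A) (omap F B)\<rbrakk> \<Longrightarrow> obj_le G A B"
  shows "locally_inductive_functor G H F"
  unfolding locally_inductive_functor_def
proof (intro conjI F allI impI)
  interpret G: ordered_groupoid G by (fact G)
  have mono: "obj_le H (omap F A) (omap F B)" if "A \<in> Obj G" "B \<in> Obj G" "obj_le G A B" for A B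
  proof -
    have "amap F (Ident G C) = Ident H (omap F C)" if "C \<in> Obj G" for C
      using F that by (simp add: ordered_functor_def cat_functor_def)
    moreover have "Le H (amap F (Ident G A)) (amap F (Ident G B))"
      using F that G.Ident_in unfolding ordered_functor_def obj_le_def by blast
    ultimately show ?thesis using that by (simp add: obj_le_def)
  qed
  fix S m assume "finite S \<and> S \<noteq> {} \<and> is_meet G (Obj G) S m"
  then have m: "S \<subseteq> Obj G" "m \<in> Obj G" "\<And>A. A \<in> S \<Longrightarrow> obj_le G m A"
    "\<And>D. \<lbrakk>D \<in> Obj G; \<forall>A\<in>S. obj_le G D A\<rbrakk> \<Longrightarrow> obj_le G D m"
    by (auto simp: is_meet_def)
  have "obj_le H D (omap F m)" if D: "D \<in> Obj H" "\<forall>B\<in>omap F ` S. obj_le H D B" for D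
  proof -
    obtain C where C: "C \<in> Obj G" "D = omap F C" using D(1) surj by blast
    have "obj_le G C A" if "A \<in> S" for A
      using refl[OF C(1), of A] D(2) C(2) m(1) that by blast
    then show ?thesis using mono[OF C(1) m(2)] m(4)[OF C(1)] C(2) by blast
  qed
  moreover have "omap F ` S \<subseteq> Obj H" "omap F m \<in> Obj H" using m(1,2) surj by blast+
  moreover have "obj_le H (omap F m) B" if "B \<in> omap F ` S" for B
    using that m(1,2,3) mono by blast
  ultimately show "is_meet H (Obj H) (omap F ` S) (omap F m)"
    by (simp add: is_meet_def)
qed

text \<open>
  The objects of \<open>\<G>(\<I>(G))\<close> are the identity arrows of \<open>G\<close>, so \<open>Dom G\<close> sends such an object to the object
  of \<open>G\<close> that it stands for.
\<close>

definition counit :: "'u lig \<Rightarrow> ('u, 'u, 'u, 'u) fmap"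
where
  "counit G = \<lparr>omap = restrict (Dom G) (Obj (G_obj (I_obj G))), amap = (\<lambda>f\<in>Arr G. f)\<rparr>"

definition counit_inverse :: "'u lig \<Rightarrow> ('u, 'u, 'u, 'u) fmap"
where
  "counit_inverse G = \<lparr>omap = restrict (Ident G) (Obj G), amap = (\<lambda>f\<in>Arr G. f)\<rparr>"

lemma Obj_G_I_obj:
  assumes "locally_inductive_groupoid G"
  shows "Obj (G_obj (I_obj G)) = Ident G ` Obj G"
proof -
  interpret locally_inductive_groupoid G by (fact assms)
  show ?thesis by (simp add: idems_I_obj[OF assms] flip: Blk_cover)  auto
qed

lemma
  fixes G :: "'u lig"
  assumes G: "locally_inductive_groupoid G"
  shows li_functor_counit: "locally_inductive_functor (G_obj (I_obj G)) G (counit G)"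
    and li_functor_counit_inverse: "locally_inductive_functor G (G_obj (I_obj G)) (counit_inverse G)"
proof -
  interpret locally_inductive_groupoid G by (fact G)
  let ?H = "G_obj (I_obj G)"
  have H: "ordered_groupoid ?H"
    by (rule ordered_groupoid_G_obj[OF inverse_semicategory_I_obj[OF G]])
  have Dom_H: "Dom ?H f = Ident G (Dom G f)" and Cod_H: "Cod ?H f = Ident G (Cod G f)"
    if "f \<in> Arr G" for f
    using that by (simp_all add: bar_I_obj[OF G] circ_I_obj[OF G] inv_simps)
  have Ident_inj: "A = B" if "A \<in> Obj G" "B \<in> Obj G" "Ident G A = Ident G B" for A B
    using arg_cong[OF that(3), of "Dom G"] that(1,2) by (simp add: Dom_Ident)
  have omap_counit: "omap (counit G) (Ident G A) = A" if "A \<in> Obj G" for A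
    using that by (simp add: counit_def Obj_G_I_obj[OF G] Dom_Ident del: G_obj_simps(1))
  have omap_inverse: "omap (counit_inverse G) A = Ident G A" if "A \<in> Obj G" for A
    using that by (simp add: counit_inverse_def)
  have amap_counit: "amap (counit G) f = f" "amap (counit_inverse G) f = f" if "f \<in> Arr G" for f
    using that by (simp_all add: counit_def counit_inverse_def)
  have obj_le_H: "obj_le ?H (Ident G A) (Ident G B) \<longleftrightarrow> obj_le G A B" if "A \<in> Obj G" "B \<in> Obj G" for A B
    using that by (simp add: obj_le_def nat_le_I_obj[OF G] Ident_in)
  have Comp_H: "g \<cdot>\<^bsub>?H\<^esub> f = g \<cdot>\<^bsub>G\<^esub> f" if "f \<in> Arr G" "g \<in> Arr G" "Dom G g = Cod G f" for f g
    using that by (simp add: tensor_Comp)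
  have Dom_Cod: "Dom G g = Cod G f" if "f \<in> Arr G" "g \<in> Arr G" "Dom ?H g = Cod ?H f" for f g
    using that Ident_inj[of "Dom G g" "Cod G f"] Dom_H Cod_H Dom_in Cod_in by simp
  show "locally_inductive_functor ?H G (counit G)"
  proof (rule li_functor_order_isoI[OF H])
    show "ordered_functor ?H G (counit G)"
      unfolding ordered_functor_def cat_functor_def semifunctor_def Obj_G_I_obj[OF G]
      using Dom_Cod
      by (auto simp: omap_counit amap_counit Dom_H Cod_H Dom_in Cod_in Comp_in Comp_H Ident_in nat_le_I_obj[OF G]
        simp del: G_obj_simps(1,3,4,5) I_obj_simps(3,4,5))
    show "omap (counit G) ` Obj ?H = Obj G"
      unfolding Obj_G_I_obj[OF G] by (auto simp: omap_counit image_iff)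
    fix A B assume "A \<in> Obj ?H" "B \<in> Obj ?H" "obj_le G (omap (counit G) A) (omap (counit G) B)"
    then show "obj_le ?H A B"
      unfolding Obj_G_I_obj[OF G] using obj_le_H by (auto simp only: omap_counit elim!: imageE)
  qed
  show "locally_inductive_functor G ?H (counit_inverse G)"
  proof (rule li_functor_order_isoI[OF ordered_groupoid_axioms])
    show "ordered_functor G ?H (counit_inverse G)"
      unfolding ordered_functor_def cat_functor_def semifunctor_def Obj_G_I_obj[OF G]
      by (auto simp: omap_inverse amap_counit Dom_H Cod_H Dom_in Cod_in Comp_in Comp_H Ident_in nat_le_I_obj[OF G]
        simp del: G_obj_simps(1,3,4,5) I_obj_simps(3,4,5))
    show "omap (counit_inverse G) ` Obj G = Obj ?H"
      unfolding Obj_G_I_obj[OF G] by (rule image_cong) (simp_all add: omap_inverse)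
    fix A B assume "A \<in> Obj G" "B \<in> Obj G"
      "obj_le ?H (omap (counit_inverse G) A) (omap (counit_inverse G) B)"
    then show "obj_le G A B"
      using obj_le_H by (simp only: omap_inverse)
  qed
qed

lemma natural_isomorphism_counit:
  "natural_isomorphism (liGrpd :: ('u lig, ('u lig, 'u) arrow) cat) liGrpd
    (fmap_comp liGrpd G_functor I_functor) (fmap_id liGrpd) (\<lambda>G. (G_obj (I_obj G), G, counit G))"
  unfolding natural_isomorphism_def
proof (intro conjI ballI)
  fix G :: "'u lig" assume "G \<in> Obj liGrpd"
  then have G: "locally_inductive_groupoid G" by (simp add: liGrpd_concrete concrete_cat_def)
  interpret locally_inductive_groupoid G by (fact G)
  have GIG: "G_obj (I_obj G) \<in> li_groupoids"
    using G by (intro I_obj_in G_obj_in) simp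
  have ext: "fmap_extensional (G_obj (I_obj G)) (counit G)" "fmap_extensional G (counit_inverse G)"
    by (simp_all add: fmap_extensional_def counit_def counit_inverse_def)
  show "(G_obj (I_obj G), G, counit G) \<in> Arr liGrpd"
    "Dom liGrpd (G_obj (I_obj G), G, counit G) = omap (fmap_comp liGrpd G_functor I_functor) G"
    "Cod liGrpd (G_obj (I_obj G), G, counit G) = omap (fmap_id liGrpd) G"
    using G GIG li_functor_counit[OF G] ext \<open>G \<in> Obj liGrpd\<close>
    by (simp_all add: liGrpd_concrete concrete_cat_def G_functor_def I_functor_def)
  show "iso_arrow liGrpd (G_obj (I_obj G), G, counit G)"
    unfolding liGrpd_concrete
  proof (rule concrete_category.iso_arrowI[OF concrete_category_liGrpd GIG _ li_functor_counit[OF G]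
        ext(1) li_functor_counit_inverse[OF G] ext(2)])
    fix e assume "e \<in> Obj (G_obj (I_obj G))"
    then obtain A where "A \<in> Obj G" "e = Ident G A" unfolding Obj_G_I_obj[OF G] by blast
    then show "omap (counit_inverse G) (omap (counit G) e) = e"
      by (simp add: counit_inverse_def counit_def Obj_G_I_obj[OF G] Dom_Ident del: G_obj_simps(1))
  next
    fix A assume "A \<in> Obj G"
    then show "omap (counit G) (omap (counit_inverse G) A) = A"
      by (simp add: counit_inverse_def counit_def Obj_G_I_obj[OF G] Dom_Ident del: G_obj_simps(1))
  qed (use G in \<open>simp_all add: counit_def counit_inverse_def\<close>)
next
  fix \<phi> :: "('u lig, 'u) arrow" assume phi: "\<phi> \<in> Arr liGrpd"
  then obtain G H F where \<phi>: "\<phi> = (G, H, F)" and G: "locally_inductive_groupoid G"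
    and H: "locally_inductive_groupoid H" and F: "locally_inductive_functor G H F"
    by (auto simp: liGrpd_concrete concrete_cat_def)
  interpret G: locally_inductive_groupoid G by (fact G)
  interpret H: locally_inductive_groupoid H by (fact H)
  let ?K = "G_obj (I_obj G)"
  let ?L = "G_fmap (I_obj G) (I_fmap G H F)"
  note f = li_functor_simps[OF G H F]
  have "fmap_comp ?K F (counit G) = fmap_comp ?K (counit H) ?L"
  proof (rule fmap_eqI[of ?K])
    fix e assume eK: "e \<in> Obj ?K"
    then obtain A where A: "A \<in> Obj G" "e = Ident G A" unfolding Obj_G_I_obj[OF G] by blast
    have "omap (counit G) e = A"
      using A eK by (simp add: counit_def G.Dom_Ident del: G_obj_simps(1))
    moreover have "omap ?L e = Ident H (omap F A)"
      using A eK f by (simp add: G_fmap_def I_fmap_def del: G_obj_simps(1))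
    moreover have "omap (counit H) (Ident H (omap F A)) = omap F A"
      using A f by (simp add: counit_def Obj_G_I_obj[OF H] H.Dom_Ident del: G_obj_simps(1))
    ultimately show "omap (fmap_comp ?K F (counit G)) e = omap (fmap_comp ?K (counit H) ?L) e"
      using eK by (simp del: G_obj_simps(1))
  qed (simp_all add: counit_def G_fmap_def I_fmap_def f)
  moreover have "amap (fmap_comp liGrpd G_functor I_functor) \<phi> = (?K, G_obj (I_obj H), ?L)"
    using phi by (simp add: \<phi> G_functor_def I_functor_def G_fmap_def I_fmap_def)
  moreover have "amap (fmap_id liGrpd) \<phi> = \<phi>" using phi by simp
  ultimately show "amap (fmap_id liGrpd) \<phi> \<cdot>\<^bsub>liGrpd\<^esub>
      (G_obj (I_obj (Dom liGrpd \<phi>)), Dom liGrpd \<phi>, counit (Dom liGrpd \<phi>))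
    = (G_obj (I_obj (Cod liGrpd \<phi>)), Cod liGrpd \<phi>, counit (Cod liGrpd \<phi>)) \<cdot>\<^bsub>liGrpd\<^esub>
      amap (fmap_comp liGrpd G_functor I_functor) \<phi>"
    by (simp add: \<phi> liGrpd_concrete concrete_cat_def)
qed

theorem corollary2p17:
  shows "equivalence_of_categories
    (isCat :: ('u isc, ('u isc, 'u) arrow) cat) (liGrpd :: ('u lig, ('u lig, 'u) arrow) cat)
    G_functor I_functor"
  unfolding equivalence_of_categories_def
proof (intro conjI G_functor_cat_functor I_functor_cat_functor)
  show "category (isCat :: ('u isc, ('u isc, 'u) arrow) cat)"
    unfolding isCat_concrete by (rule concrete_category.category[OF concrete_category_isCat])
  show "category (liGrpd :: ('u lig, ('u lig, 'u) arrow) cat)"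
    unfolding liGrpd_concrete by (rule concrete_category.category[OF concrete_category_liGrpd])
qed (use natural_isomorphism_unit natural_isomorphism_counit in blast)+

end
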